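(* Let $L$ be a finite-dimensional complex Leibniz algebra and let $I$ be the ideal of $L$ generated by all squares $[x,x]$, $x\in L$. Suppose that: (a) $L/I\cong sl_2^1\oplus sl_2^2$, where $sl_2^1,sl_2^2$ are two copies of $sl_2$; (b) $I=I_{1,1}\oplus I_{1,2}$, where $I_{1,1},I_{1,2}$ are irreducible $sl_2^1$-modules with $\dim I_{1,1}=\dim I_{1,2}=m+1$. Then either (c) $I=I_{2,1}\oplus I_{2,2}\oplus\dots\oplus I_{2,m+1}$ for some irreducible $sl_2^2$-modules $I_{2,k}$, $1\le k\le m+1$, or $L\cong(sl_2^1+I)\oplus sl_2^2$.
   Context: All vector spaces and algebras are finite-dimensional over $\mathbb{C}$. A (right) Leibniz algebra is an algebra $(L,[\cdot,\cdot])$ satisfying $[x,[y,z]]=[[x,y],z]-[[x,z],y]$ for all $x,y,z\in L$. The quotient $L/I$ is a Lie algebra. Since right multiplication by elements of $I$ is zero, $I$ is a right $L/I$-module via $x\cdot\bar a=[x,a]$ ($x\in I$, $a\in L$), and hence a right module over $sl_2^1$ and over $sl_2^2$. By Levi's theorem for Leibniz algebras, $sl_2^1\oplus sl_2^2$ can be regarded as a subalgebra of $L$ complementary to $I$. An irreducible module is a non-zero module whose only submodules are itself and zero. The symbol $+$ denotes the direct sum of vector spaces (so $sl_2^1+I$ is the subalgebra of $L$ with underlying space $sl_2^1+I$); in the final isomorphism $\oplus$ denotes the direct sum of algebras. *)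

theory Defs
  imports "HOL-Analysis.Analysis"
begin
locale leibniz_algebra = vector_space scl
  for scl :: "complex \<Rightarrow> 'a::ab_group_add \<Rightarrow> 'a" +
  fixes br :: "'a \<Rightarrow> 'a \<Rightarrow> 'a"
  assumes linear_left: "Vector_Spaces.linear scl scl (\<lambda>x. br x y)"
    and linear_right: "Vector_Spaces.linear scl scl (\<lambda>y. br x y)"
    and leibniz_identity: "br x (br y z) = br (br x y) z - br (br x z) y"

definition leibniz_ideal ::
  "(complex \<Rightarrow> 'a::ab_group_add \<Rightarrow> 'a) \<Rightarrow> ('a \<Rightarrow> 'a \<Rightarrow> 'a) \<Rightarrow> 'a set \<Rightarrow> bool" where
  "leibniz_ideal scl br J \<longleftrightarrow>
     module.subspace scl J \<and> (\<forall>x\<in>J. \<forall>a. br x a \<in> J \<and> br a x \<in> J)"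

definition squares_ideal ::
  "(complex \<Rightarrow> 'a::ab_group_add \<Rightarrow> 'a) \<Rightarrow> ('a \<Rightarrow> 'a \<Rightarrow> 'a) \<Rightarrow> 'a set" where
  "squares_ideal scl br = leibniz_ideal scl br hull range (\<lambda>x. br x x)"

text \<open>A complex algebra whose underlying space need not be a whole type. The record is only
  used to compare a Leibniz algebra, its subalgebras and its quotients with one another up to
  isomorphism.\<close>

record 'b alg =
  alg_carrier :: "'b set"
  alg_add :: "'b \<Rightarrow> 'b \<Rightarrow> 'b"
  alg_scale :: "complex \<Rightarrow> 'b \<Rightarrow> 'b"
  alg_br :: "'b \<Rightarrow> 'b \<Rightarrow> 'b"

definition alg_isomorphism :: "('b \<Rightarrow> 'c) \<Rightarrow> 'b alg \<Rightarrow> 'c alg \<Rightarrow> bool" where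
  "alg_isomorphism f A B \<longleftrightarrow>
     bij_betw f (alg_carrier A) (alg_carrier B) \<and>
     (\<forall>x\<in>alg_carrier A. \<forall>y\<in>alg_carrier A.
        f (alg_add A x y) = alg_add B (f x) (f y) \<and>
        f (alg_br A x y) = alg_br B (f x) (f y)) \<and>
     (\<forall>c. \<forall>x\<in>alg_carrier A. f (alg_scale A c x) = alg_scale B c (f x))"

definition alg_isomorphic :: "'b alg \<Rightarrow> 'c alg \<Rightarrow> bool" where
  "alg_isomorphic A B \<longleftrightarrow> (\<exists>f. alg_isomorphism f A B)"

definition alg_sum :: "'b alg \<Rightarrow> 'c alg \<Rightarrow> ('b \<times> 'c) alg" where
  "alg_sum A B =
     \<lparr>alg_carrier = alg_carrier A \<times> alg_carrier B,
      alg_add = (\<lambda>(x, y) (x', y'). (alg_add A x x', alg_add B y y')),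
      alg_scale = (\<lambda>c (x, y). (alg_scale A c x, alg_scale B c y)),
      alg_br = (\<lambda>(x, y) (x', y'). (alg_br A x x', alg_br B y y'))\<rparr>"

definition sub_alg ::
  "(complex \<Rightarrow> 'a::ab_group_add \<Rightarrow> 'a) \<Rightarrow> ('a \<Rightarrow> 'a \<Rightarrow> 'a) \<Rightarrow> 'a set \<Rightarrow> 'a alg" where
  "sub_alg scl br S =
     \<lparr>alg_carrier = S, alg_add = (+), alg_scale = scl, alg_br = br\<rparr>"

definition coset_rel :: "'a::ab_group_add set \<Rightarrow> ('a \<times> 'a) set" where
  "coset_rel J = {(x, y). x - y \<in> J}"

definition quotient_alg ::
  "(complex \<Rightarrow> 'a::ab_group_add \<Rightarrow> 'a) \<Rightarrow> ('a \<Rightarrow> 'a \<Rightarrow> 'a) \<Rightarrow> 'a set \<Rightarrow> 'a set alg" where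
  "quotient_alg scl br J =
     \<lparr>alg_carrier = UNIV // coset_rel J,
      alg_add = (\<lambda>X Y. \<Union>x\<in>X. \<Union>y\<in>Y. coset_rel J `` {x + y}),
      alg_scale = (\<lambda>c X. \<Union>x\<in>X. coset_rel J `` {scl c x}),
      alg_br = (\<lambda>X Y. \<Union>x\<in>X. \<Union>y\<in>Y. coset_rel J `` {br x y})\<rparr>"

definition sl2 :: "(complex^2^2) alg" where
  "sl2 =
     \<lparr>alg_carrier = {A. trace A = 0},
      alg_add = (+),
      alg_scale = (\<lambda>c A. \<chi> i j. c * A $ i $ j),
      alg_br = (\<lambda>A B. A ** B - B ** A)\<rparr>"

text \<open>The action of a class \<open>X\<close> of \<open>L/I\<close> on \<open>x\<close>: the common value of \<open>br x a\<close> for \<open>a \<in> X\<close>.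
  It exists because right multiplication by an element of the ideal \<open>I\<close> generated by the
  squares is zero; for other ideals this is not meaningful.\<close>

definition quotient_act :: "('a \<Rightarrow> 'a \<Rightarrow> 'a) \<Rightarrow> 'a \<Rightarrow> 'a set \<Rightarrow> 'a" where
  "quotient_act br x X = the_elem (br x ` X)"

definition submodule ::
  "(complex \<Rightarrow> 'a::ab_group_add \<Rightarrow> 'a) \<Rightarrow> 'g set \<Rightarrow> ('a \<Rightarrow> 'g \<Rightarrow> 'a) \<Rightarrow> 'a set \<Rightarrow> bool" where
  "submodule scl G act W \<longleftrightarrow>
     module.subspace scl W \<and> (\<forall>w\<in>W. \<forall>g\<in>G. act w g \<in> W)"

definition irreducible_submodule ::
  "(complex \<Rightarrow> 'a::ab_group_add \<Rightarrow> 'a) \<Rightarrow> 'g set \<Rightarrow> ('a \<Rightarrow> 'g \<Rightarrow> 'a) \<Rightarrow> 'a set \<Rightarrow> bool" where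
  "irreducible_submodule scl G act W \<longleftrightarrow>
     submodule scl G act W \<and> W \<noteq> {0} \<and>
     (\<forall>U. submodule scl G act U \<and> U \<subseteq> W \<longrightarrow> U = {0} \<or> U = W)"

text \<open>The actions of the two copies of \<open>sl2\<close> on the Leibniz kernel, for an isomorphism
  \<open>\<phi>\<close> from \<open>alg_sum sl2 sl2\<close> onto \<open>L/I\<close>.\<close>

definition act1 ::
  "('a \<Rightarrow> 'a \<Rightarrow> 'a) \<Rightarrow> ((complex^2^2) \<times> (complex^2^2) \<Rightarrow> 'a set) \<Rightarrow> 'a \<Rightarrow> complex^2^2 \<Rightarrow> 'a" where
  "act1 br \<phi> x A = quotient_act br x (\<phi> (A, 0))"

definition act2 ::
  "('a \<Rightarrow> 'a \<Rightarrow> 'a) \<Rightarrow> ((complex^2^2) \<times> (complex^2^2) \<Rightarrow> 'a set) \<Rightarrow> 'a \<Rightarrow> complex^2^2 \<Rightarrow> 'a" where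
  "act2 br \<phi> x A = quotient_act br x (\<phi> (0, A))"

text \<open>Internal direct sum of a finite family of subspaces: every vector of \<open>V\<close> is the sum of
  a unique family of components.\<close>

definition internal_direct_sum ::
  "'a::ab_group_add set \<Rightarrow> 'i set \<Rightarrow> ('i \<Rightarrow> 'a set) \<Rightarrow> bool" where
  "internal_direct_sum V K W \<longleftrightarrow> bij_betw (\<lambda>f. \<Sum>k\<in>K. f k) (Pi\<^sub>E K W) V"

definition levi_complement ::
  "(complex \<Rightarrow> 'a::ab_group_add \<Rightarrow> 'a) \<Rightarrow> ('a \<Rightarrow> 'a \<Rightarrow> 'a) \<Rightarrow> 'a set \<Rightarrow> 'a set \<Rightarrow> bool" where
  "levi_complement scl br I S \<longleftrightarrow>
     module.subspace scl S \<and> (\<forall>x\<in>S. \<forall>y\<in>S. br x y \<in> S) \<and>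
     S \<inter> I = {0} \<and> {s + i |s i. s \<in> S \<and> i \<in> I} = UNIV"

text \<open>The quotient map identifies a Levi complement \<open>S\<close> with \<open>L/I\<close>; these are the subalgebras
  of \<open>S\<close> corresponding to the two copies of \<open>sl2\<close> in \<open>L/I\<close>.\<close>

definition levi1 ::
  "'a::ab_group_add set \<Rightarrow> ((complex^2^2) \<times> (complex^2^2) \<Rightarrow> 'a set) \<Rightarrow> 'a set \<Rightarrow> 'a set" where
  "levi1 I \<phi> S = {x \<in> S. \<exists>A\<in>alg_carrier sl2. coset_rel I `` {x} = \<phi> (A, 0)}"

definition levi2 ::
  "'a::ab_group_add set \<Rightarrow> ((complex^2^2) \<times> (complex^2^2) \<Rightarrow> 'a set) \<Rightarrow> 'a set \<Rightarrow> 'a set" where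
  "levi2 I \<phi> S = {x \<in> S. \<exists>A\<in>alg_carrier sl2. coset_rel I `` {x} = \<phi> (0, A)}"

end

theory Submission
  imports Defs "HOL-Computational_Algebra.Fundamental_Theorem_Algebra"
begin

text \<open>Write \<open>L/I\<close> as a sum of two copies of \<open>sl2\<close>. As a module over the first copy, \<open>I\<close> is
  \<open>V\<^sub>m \<otimes> \<complex>\<^sup>2\<close>, and the second copy acts on each weight space of the first,
  a plane. If all these planes are irreducible, they are the required summands. If one of them is
  reducible, the second copy acts on it by triangular matrices, hence by zero because \<open>sl2\<close> is
  perfect; moving along the weight strings of the first copy, it acts by zero on \<open>I\<close>.

  In that case a Levi complement is found as a submodule of the right \<open>L/I\<close>-module \<open>L\<close>: any right
  submodule complementary to \<open>I\<close> is a subalgebra. It is generated by a highest weight vector of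
  weight 2 over each copy of \<open>sl2\<close>. In any Levi complement the two factors annihilate each other,
  and the second one annihilates \<open>I\<close> from both sides.\<close>

subsection \<open>Eigenvectors\<close>

text \<open>The second alternative asserts that a Levi complement exists, so one has to be built
  there. Since the second copy then annihilates \<open>I\<close>, the two factors of
  \<open>L/I\<close> can be lifted separately: each is an adjoint module, to be split off from an
  extension by \<open>I\<close>. On the module with highest weight n the Casimir operator is n (n +
  2), which separates it from the adjoint module except when n = 2. This case is the obstacle: for
  the first copy \<open>I\<close> is then itself a sum of adjoint modules, and \<open>H\<close>
  could have a nilpotent part on the generalised weight space 2. A computation with
  \<open>E (F (F (F x)))\<close> shows that this part vanishes. The copies are not treated alike:
  the first acts on \<open>I\<close> with highest weight \<open>m\<close>, the second by zero, so
  that each needs its own reason why it annihilates the lift of the other factor.\<close>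

context vector_space
begin

text \<open>Subtracting \<open>l j\<close> times the relation from its image under \<open>T\<close>
  removes the summand at \<open>j\<close>. Zero summands are allowed, so that the weight components
  of two expansions can be compared.\<close>

lemma eigenvectors_sum_zero:
  assumes T: "Vector_Spaces.linear scale scale T"
    and fin: "finite K" and inj: "inj_on l K"
    and eig: "\<And>k. k \<in> K \<Longrightarrow> T (u k) = scale (l k) (u k)"
    and sum: "(\<Sum>k\<in>K. u k) = 0" and k: "k \<in> K"
  shows "u k = 0"
  using fin inj eig sum k
proof (induction K arbitrary: u k rule: finite_induct)
  case empty
  then show ?case by simp
next
  case (insert j K)
  interpret T: Vector_Spaces.linear scale scale T by (rule T)
  have s: "u j = - (\<Sum>k\<in>K. u k)"
    using insert.prems(3) insert.hyps by (simp add: eq_neg_iff_add_eq_0)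
  have ne: "l k \<noteq> l j" if "k \<in> K" for k
    using that insert.prems(1) insert.hyps by (auto simp: inj_on_def)
  have "T (\<Sum>k\<in>insert j K. u k) = (\<Sum>k\<in>insert j K. scale (l k) (u k))"
    unfolding T.sum by (rule sum.cong) (use insert.prems(2) in auto)
  then have "(\<Sum>k\<in>insert j K. scale (l k) (u k)) = 0"
    using insert.prems(3) by (simp add: T.zero)
  then have "(\<Sum>k\<in>insert j K. scale (l k) (u k)) - scale (l j) (\<Sum>k\<in>insert j K. u k) = 0"
    using insert.prems(3) by simp
  then have "(\<Sum>k\<in>K. scale (l k - l j) (u k)) = 0"
    using insert.hyps
    by (simp add: scale_sum_right sum_subtractf scale_left_diff_distrib scale_right_distrib)
  then have z: "scale (l k - l j) (u k) = 0" if "k \<in> K" for k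
    using that insert.IH[of "\<lambda>k. scale (l k - l j) (u k)"] insert.prems
    by (auto simp: T.scale mult.commute)
  have K: "u k = 0" if "k \<in> K" for k
    using z[OF that] ne[OF that] by simp
  then have "u j = 0" using s by simp
  then show ?case using K insert.prems(4) by auto
qed

lemma eigenvectors_independent:
  assumes T: "Vector_Spaces.linear scale scale T"
    and inj: "inj_on l K"
    and eig: "\<And>k. k \<in> K \<Longrightarrow> T (u k) = scale (l k) (u k)"
    and nz: "\<And>k. k \<in> K \<Longrightarrow> u k \<noteq> 0"
  shows "inj_on u K" "independent (u ` K)"
proof -
  interpret T: Vector_Spaces.linear scale scale T by (rule T)
  show inju: "inj_on u K"
  proof (rule inj_onI)
    fix i j assume ij: "i \<in> K" "j \<in> K" "u i = u j"
    have "scale (l i) (u i) = T (u i)"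
      by (rule eig[OF ij(1), symmetric])
    also have "\<dots> = scale (l j) (u i)"
      unfolding ij(3) by (rule eig[OF ij(2)])
    finally have "l i = l j" by (rule scale_right_imp_eq[OF nz[OF ij(1)]])
    then show "i = j" using inj_onD[OF inj _ ij(1,2)] by blast
  qed
  show "independent (u ` K)"
    unfolding dependent_explicit
  proof safe
    fix t c w assume t: "finite t" "t \<subseteq> u ` K" "(\<Sum>v\<in>t. scale (c v) v) = 0"
      and w: "w \<in> t" "c w \<noteq> 0"
    obtain k where v: "u k \<in> t" "c (u k) \<noteq> 0" "k \<in> K"
      using w t(2) by blast
    define J where "J = {k\<in>K. u k \<in> t}"
    have J: "t = u ` J" "J \<subseteq> K" using t by (auto simp: J_def)
    have iJ: "inj_on u J" using inju J(2) by (rule inj_on_subset)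
    have fJ: "finite J" using t(1) J iJ finite_imageD by blast
    have "(\<Sum>k\<in>J. scale (c (u k)) (u k)) = 0"
      using t(3) unfolding J(1) by (simp add: sum.reindex[OF iJ])
    moreover have "T (scale (c (u i)) (u i)) = scale (l i) (scale (c (u i)) (u i))" if "i \<in> J" for i
      using eig[of i] J(2) that by (simp add: T.scale mult.commute subset_iff)
    ultimately have "scale (c (u k)) (u k) = 0"
      using eigenvectors_sum_zero[OF T fJ inj_on_subset[OF inj J(2)],
          of "\<lambda>k. scale (c (u k)) (u k)" k] v(1,3) by (simp add: J_def)
    then show False using v nz by simp
  qed
qed

end

context finite_dimensional_vector_space
begin

text \<open>Needed to end weight strings: the powers of \<open>E\<close> or of \<open>F\<close> send
  an eigenvector of \<open>H\<close> to vectors with pairwise distinct eigenvalues.\<close>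

lemma eigenvector_chain_stops:
  assumes T: "Vector_Spaces.linear scale scale T" and inj: "inj l"
    and eig: "\<And>k::nat. T (u k) = scale (l k) (u k)"
  shows "\<exists>k. u k = 0"
proof (rule ccontr)
  assume "\<nexists>k. u k = 0"
  then have "inj u" "independent (range u)"
    using eigenvectors_independent[OF T inj, of u] eig by auto
  then show False
    using finiteI_independent range_inj_infinite by blast
qed

end

text \<open>Take a nonzero polynomial of least degree that annihilates \<open>x\<close> and split
  off a linear factor: the cofactor, applied to \<open>x\<close>, is nonzero by minimality and is an
  eigenvector for the root. All vectors involved are combinations of powers of \<open>T\<close> at
  \<open>x\<close>, hence lie in \<open>V\<close>.\<close>

lemma exists_eigenvector:
  fixes scl :: "complex \<Rightarrow> 'a::ab_group_add \<Rightarrow> 'a"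
  assumes fd: "finite_dimensional_vector_space scl B"
    and T: "Vector_Spaces.linear scl scl T"
    and V: "module.subspace scl V" and TV: "\<And>x. x \<in> V \<Longrightarrow> T x \<in> V"
    and x: "x \<in> V" "x \<noteq> 0"
  shows "\<exists>y z. y \<in> V \<and> y \<noteq> 0 \<and> T y = scl z y"
proof -
  interpret finite_dimensional_vector_space scl B by (rule fd)
  interpret T: Vector_Spaces.linear scl scl T by (rule T)
  \<comment> \<open>\<open>ev p\<close> is the operator p(T).\<close>
  define ev where "ev p y = (\<Sum>i\<le>degree p. scl (coeff p i) ((T ^^ i) y))" for p :: "complex poly" and y
  have ev_ge: "ev p y = (\<Sum>i\<le>n. scl (coeff p i) ((T ^^ i) y))" if "degree p \<le> n" for p y n
    unfolding ev_def using that
    by (intro sum.mono_neutral_left) (auto simp: coeff_eq_0)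
  have pow: "(T ^^ i) x \<in> V" for i
    by (induction i) (use x TV in auto)
  have evV: "ev p x \<in> V" for p
    unfolding ev_def by (intro subspace_sum subspace_scale pow V)
  have ev_root: "ev ([:-z, 1:] * q) x = T (ev q x) - scl z (ev q x)" for z q
  proof (cases "q = 0")
    case True
    then show ?thesis by (simp add: ev_def T.zero)
  next
    case False
    then have d: "degree ([:-z, 1:] * q) = Suc (degree q)"
      by (subst degree_mult_eq) auto
    let ?n = "degree q"
    have c: "coeff ([:-z, 1:] * q) i = (case i of 0 \<Rightarrow> 0 | Suc j \<Rightarrow> coeff q j) - z * coeff q i" for i
      by (simp add: coeff_pCons split: nat.split)
    have "ev ([:-z, 1:] * q) x =
        (\<Sum>i\<le>Suc ?n. scl (case i of 0 \<Rightarrow> 0 | Suc j \<Rightarrow> coeff q j) ((T ^^ i) x))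
        - (\<Sum>i\<le>Suc ?n. scl (z * coeff q i) ((T ^^ i) x))"
      unfolding ev_def d c scale_left_diff_distrib sum_subtractf ..
    also have "(\<Sum>i\<le>Suc ?n. scl (z * coeff q i) ((T ^^ i) x)) = scl z (ev q x)"
      unfolding ev_ge[of q "Suc ?n", OF le_SucI[OF order_refl]] scale_sum_right scale_scale ..
    also have "(\<Sum>i\<le>Suc ?n. scl (case i of 0 \<Rightarrow> 0 | Suc j \<Rightarrow> coeff q j) ((T ^^ i) x))
        = (\<Sum>i\<le>?n. scl (coeff q i) ((T ^^ Suc i) x))"
      by (subst sum.atMost_Suc_shift) simp
    also have "\<dots> = T (ev q x)"
      unfolding ev_def by (simp add: T.sum T.scale)
    finally show ?thesis .
  qed
  have ex: "\<exists>p. p \<noteq> 0 \<and> ev p x = 0"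
  \<comment> \<open>Dependence of the range is a statement about a set, so it gives a relation
    between powers only if they are distinct. A repetition yields the annihilating polynomial X^i -
    X^j directly.\<close>
  proof (cases "inj (\<lambda>i. (T ^^ i) x)")
    case True
    then have "infinite (range (\<lambda>i. (T ^^ i) x))" by (rule range_inj_infinite)
    then have "dependent (range (\<lambda>i. (T ^^ i) x))"
      using finiteI_independent by blast
    then obtain t c v where t: "finite t" "t \<subseteq> range (\<lambda>i. (T ^^ i) x)"
      "(\<Sum>v\<in>t. scl (c v) v) = 0" "v \<in> t" "c v \<noteq> 0"
      unfolding dependent_explicit by blast
    define J where "J = {i. (T ^^ i) x \<in> t}"
    have J: "t = (\<lambda>i. (T ^^ i) x) ` J" using t(2) by (auto simp: J_def)
    have iJ: "inj_on (\<lambda>i. (T ^^ i) x) J" using True by (rule inj_on_subset) simp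
    have fJ: "finite J" using t(1) J iJ finite_imageD by blast
    obtain k where k: "k \<in> J" "v = (T ^^ k) x" using t(4) J by auto
    define p where "p = (\<Sum>i\<in>J. monom (c ((T ^^ i) x)) i)"
    have cp: "coeff p i = (if i \<in> J then c ((T ^^ i) x) else 0)" for i
      unfolding p_def by (simp add: coeff_sum fJ)
    have "p \<noteq> 0" using cp[of k] k t(5) by auto
    obtain n where n: "degree p \<le> n" "J \<subseteq> {..n}"
      using finite_nat_iff_bounded_le[of "insert (degree p) J"] fJ by auto
    have "ev p x = (\<Sum>i\<in>J. scl (c ((T ^^ i) x)) ((T ^^ i) x))"
      unfolding ev_ge[OF n(1)] using n(2)
      by (intro sum.mono_neutral_cong_right) (auto simp: cp)
    also have "\<dots> = 0" using t(3) unfolding J by (simp add: sum.reindex[OF iJ])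
    finally show ?thesis using \<open>p \<noteq> 0\<close> by blast
  next
    case False
    then obtain i j where ij: "i \<noteq> j" "(T ^^ i) x = (T ^^ j) x" by (auto simp: inj_def)
    define p where "p = monom 1 i - monom (1::complex) j"
    have cp: "coeff p k = (if k = i then 1 else 0) - (if k = j then 1 else 0)" for k
      by (simp add: p_def)
    have "p \<noteq> 0" using cp[of i] ij by auto
    obtain n where le: "degree p \<le> n" "i \<le> n" "j \<le> n"
      by (meson linorder_le_cases order_trans)
    have "ev p x = (\<Sum>k\<le>n. (if k = i then (T ^^ i) x else 0) - (if k = j then (T ^^ j) x else 0))"
      unfolding ev_ge[OF le(1)] by (auto simp: cp scale_left_diff_distrib intro!: sum.cong)
    also have "\<dots> = 0" using ij le by (simp add: sum_subtractf)
    finally show ?thesis using \<open>p \<noteq> 0\<close> by blast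
  qed
  obtain p where p: "p \<noteq> 0" "ev p x = 0"
    and min: "\<And>q. q \<noteq> 0 \<Longrightarrow> ev q x = 0 \<Longrightarrow> degree p \<le> degree q"
    using ex ex_has_least_nat[of "\<lambda>p. p \<noteq> 0 \<and> ev p x = 0" _ degree] by blast
  have "degree p \<noteq> 0"
  proof
    assume "degree p = 0"
    then obtain c where "p = [:c:]" by (rule degree_eq_zeroE)
    then show False using p x by (simp add: ev_def)
  qed
  then have "\<not> constant (poly p)" by (simp add: constant_degree)
  then obtain z where "poly p z = 0" using fundamental_theorem_of_algebra by blast
  then obtain q where q: "p = [:-z, 1:] * q" by (auto simp: poly_eq_0_iff_dvd elim: dvdE)
  then have "q \<noteq> 0" using p by auto
  then have "degree p = Suc (degree q)" unfolding q by (subst degree_mult_eq) auto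
  then have "ev q x \<noteq> 0" using min[of q] \<open>q \<noteq> 0\<close> by auto
  moreover have "T (ev q x) = scl z (ev q x)" using p(2) unfolding q ev_root by simp
  ultimately show ?thesis using evV by blast
qed

subsection \<open>Representations of sl2\<close>

text \<open>Used as rewrite rules, the relations [E, F] = H, [H, E] = 2 E, [H, F] = -2 F bring words
  into the order F, H, E. Then \<open>E\<close> is applied first, and on a highest weight vector it
  gives zero at once. The operators live on the whole space because right multiplications act on all
  of \<open>L\<close>; modules enter as invariant subspaces.\<close>

locale sl2_triple = finite_dimensional_vector_space scl B
  for scl :: "complex \<Rightarrow> 'a::ab_group_add \<Rightarrow> 'a" and B +
  fixes E F H :: "'a \<Rightarrow> 'a"
  assumes linear_E: "Vector_Spaces.linear scl scl E"
    and linear_F: "Vector_Spaces.linear scl scl F"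
    and linear_H: "Vector_Spaces.linear scl scl H"
    and E_F: "E (F x) = F (E x) + H x"
    and E_H: "E (H x) = H (E x) - scl 2 (E x)"
    and H_F: "H (F x) = F (H x) - scl 2 (F x)"
begin

sublocale E: Vector_Spaces.linear scl scl E by (rule linear_E)
sublocale F: Vector_Spaces.linear scl scl F by (rule linear_F)
sublocale H: Vector_Spaces.linear scl scl H by (rule linear_H)

lemmas op_simps = E.add E.diff E.scale E.zero F.add F.diff F.scale F.zero
  H.add H.diff H.scale H.zero E_F E_H H_F

definition invariant :: "'a set \<Rightarrow> bool" where
  "invariant V \<longleftrightarrow> subspace V \<and> (\<forall>x\<in>V. E x \<in> V \<and> F x \<in> V \<and> H x \<in> V)"

definition irreducible :: "'a set \<Rightarrow> bool" where
  "irreducible V \<longleftrightarrow> invariant V \<and> V \<noteq> {0} \<and>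
     (\<forall>U. invariant U \<and> U \<subseteq> V \<longrightarrow> U = {0} \<or> U = V)"

section \<open>Weight strings and highest weight vectors\<close>

lemma H_E: "H (E x) = E (H x) + scl 2 (E x)"
  by (simp add: E_H)

lemma H_F_pow:
  assumes "H x = scl a x"
  shows "H ((F ^^ k) x) = scl (a - 2 * of_nat k) ((F ^^ k) x)"
proof (induction k)
  case (Suc k)
  have "H ((F ^^ Suc k) x) = scl (a - 2 * of_nat k - 2) ((F ^^ Suc k) x)"
    using Suc by (simp add: H_F F.scale F.diff scale_left_diff_distrib)
  then show ?case by (simp add: algebra_simps)
qed (use assms in simp)

lemma H_E_pow:
  assumes "H x = scl a x"
  shows "H ((E ^^ k) x) = scl (a + 2 * of_nat k) ((E ^^ k) x)"
proof (induction k)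
  case (Suc k)
  have "H ((E ^^ Suc k) x) = scl (a + 2 * of_nat k + 2) ((E ^^ Suc k) x)"
    using Suc by (simp add: H_E E.scale E.add scale_left_distrib)
  then show ?case by (simp add: algebra_simps)
qed (use assms in simp)

text \<open>Each interchange of \<open>E\<close> with an \<open>F\<close> contributes an eigenvalue
  of \<open>H\<close>, and a + (a - 2) + ... + (a - 2 k) = (k + 1) (a - k).\<close>

lemma E_F_pow:
  assumes "E x = 0" "H x = scl a x"
  shows "E ((F ^^ Suc k) x) = scl ((of_nat k + 1) * (a - of_nat k)) ((F ^^ k) x)"
proof (induction k)
  case 0
  then show ?case using assms by (simp add: E_F F.zero)
next
  case (Suc k)
  let ?u = "(F ^^ Suc k) x"
  have "E ((F ^^ Suc (Suc k)) x) = F (E ?u) + H ?u"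
    using E_F[of ?u] by simp
  also have "F (E ?u) = scl ((of_nat k + 1) * (a - of_nat k)) ?u"
    unfolding Suc.IH F.scale by simp
  also have "H ?u = scl (a - 2 * of_nat (Suc k)) ?u"
    by (rule H_F_pow[OF assms(2)])
  also have "scl ((of_nat k + 1) * (a - of_nat k)) ?u + scl (a - 2 * of_nat (Suc k)) ?u
      = scl ((of_nat (Suc k) + 1) * (a - of_nat (Suc k))) ?u"
    unfolding scale_left_distrib[symmetric] by (rule arg_cong[of _ _ "\<lambda>c. scl c ?u"]) (simp add: algebra_simps)
  finally show ?case .
qed

text \<open>The factor is the product of the (i + 1) (n - i) for i < k, nonzero as long as k does
  not exceed n. It is chosen before \<open>y\<close>, so one constant serves all highest weight
  vectors of weight n. This allows returning from any weight space to the highest one.\<close>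

lemma E_pow_F_pow:
  assumes "k \<le> n"
  shows "\<exists>c. c \<noteq> 0 \<and> (\<forall>y. E y = 0 \<longrightarrow> H y = scl (of_nat n) y \<longrightarrow> (E ^^ k) ((F ^^ k) y) = scl c y)"
  using assms
proof (induction k)
  case 0
  then show ?case by (intro exI[of _ 1]) simp
next
  case (Suc k)
  then obtain c where c: "c \<noteq> 0"
    "\<And>y. E y = 0 \<Longrightarrow> H y = scl (of_nat n) y \<Longrightarrow> (E ^^ k) ((F ^^ k) y) = scl c y"
    by auto
  define d :: complex where "d = (of_nat k + 1) * (of_nat n - of_nat k)"
  have "d \<noteq> 0" unfolding d_def using Suc.prems
    by (metis Suc_le_lessD mult_eq_0_iff nat_less_le of_nat_Suc of_nat_eq_iff of_nat_neq_0
        eq_iff_diff_eq_0 add.commute)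
  have lin: "(E ^^ k) (scl d y) = scl d ((E ^^ k) y)" for y
    by (induction k arbitrary: y) (simp_all add: E.scale)
  have "(E ^^ Suc k) ((F ^^ Suc k) y) = scl (d * c) y"
    if "E y = 0" "H y = scl (of_nat n) y" for y
  proof -
    have "(E ^^ Suc k) ((F ^^ Suc k) y) = (E ^^ k) (E ((F ^^ Suc k) y))"
      by (simp only: funpow_Suc_right o_def)
    then show ?thesis
      unfolding E_F_pow[OF that] d_def[symmetric] lin c(2)[OF that] by simp
  qed
  then show ?case using \<open>c \<noteq> 0\<close> \<open>d \<noteq> 0\<close> by (intro exI[of _ "d * c"]) auto
qed

lemma pow_mem:
  assumes "invariant V" "x \<in> V"
  shows "(E ^^ k) x \<in> V" "(F ^^ k) x \<in> V"
  using assms by (induction k) (auto simp: invariant_def)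

lemma exists_highest_weight_vector:
  assumes V: "invariant V" "V \<noteq> {0}"
  shows "\<exists>v n. v \<in> V \<and> E v = 0 \<and> H v = scl (of_nat n) v \<and>
     (F ^^ Suc n) v = 0 \<and> (\<forall>k\<le>n. (F ^^ k) v \<noteq> 0)"
proof -
  have sV: "subspace V" using V by (simp add: invariant_def)
  obtain x0 where "x0 \<in> V" "x0 \<noteq> 0" using V subspace_0[OF sV] by blast
  then obtain x a where x: "x \<in> V" "x \<noteq> 0" "H x = scl a x"
    using exists_eigenvector[OF finite_dimensional_vector_space_axioms linear_H sV] V(1)
    unfolding invariant_def by metis
  have "inj (\<lambda>k::nat. a + 2 * of_nat k)" by (auto simp: inj_def)
  from eigenvector_chain_stops[OF linear_H this, of "\<lambda>k. (E ^^ k) x"]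
  have "\<exists>k. (E ^^ k) x = 0" using H_E_pow[OF x(3)] by blast
  then obtain k where k: "(E ^^ k) x = 0" "\<And>i. i < k \<Longrightarrow> (E ^^ i) x \<noteq> 0"
    using exists_least_iff[of "\<lambda>k. (E ^^ k) x = 0"] by blast
  have "k \<noteq> 0" using k x by (intro notI) simp
  then obtain j where j: "k = Suc j" using not0_implies_Suc by blast
  define v where "v = (E ^^ j) x"
  have v: "v \<in> V" "v \<noteq> 0" "E v = 0" using k j pow_mem[OF V(1) x(1)] by (auto simp: v_def)
  obtain b where b: "H v = scl b v" using H_E_pow[OF x(3)] v_def by blast
  have "inj (\<lambda>k::nat. b - 2 * of_nat k)" by (auto simp: inj_def)
  from eigenvector_chain_stops[OF linear_H this, of "\<lambda>k. (F ^^ k) v"]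
  have "\<exists>k. (F ^^ k) v = 0" using H_F_pow[OF b] by blast
  then obtain l where l: "(F ^^ l) v = 0" "\<And>i. i < l \<Longrightarrow> (F ^^ i) v \<noteq> 0"
    using exists_least_iff[of "\<lambda>k. (F ^^ k) v = 0"] by blast
  have "l \<noteq> 0" using l v by (intro notI) simp
  then obtain n where n: "l = Suc n" using not0_implies_Suc by blast
  \<comment> \<open>The string ends with zero, so the coefficient with which \<open>E\<close> would
    lead back from there must vanish; this forces the weight to be the natural number n.\<close>
  have "scl ((of_nat n + 1) * (b - of_nat n)) ((F ^^ n) v) = 0"
    using E_F_pow[OF v(3) b, of n] l(1) n by (simp add: E.zero)
  moreover have "(F ^^ n) v \<noteq> 0" using l n by simp
  moreover have "of_nat n + 1 \<noteq> (0::complex)" by (metis of_nat_Suc of_nat_neq_0 add.commute)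
  ultimately have "b = of_nat n" by simp
  then show ?thesis using v b l n by (intro exI[of _ v] exI[of _ n]) auto
qed

text \<open>The string below a highest weight vector spans a nonzero invariant subspace, hence
  everything. The dimension formula later identifies the highest weight with
  \<open>m\<close>.\<close>

lemma irreducible_basis:
  assumes V: "irreducible V"
  shows "\<exists>v n. v \<in> V \<and> v \<noteq> 0 \<and> E v = 0 \<and> H v = scl (of_nat n) v \<and>
     dim V = n + 1 \<and> (\<forall>x\<in>V. \<exists>c. x = (\<Sum>k\<le>n. scl (c k) ((F ^^ k) v)))"
proof -
  have inv: "invariant V" and "V \<noteq> {0}" using V by (auto simp: irreducible_def)
  then obtain v n where v: "v \<in> V" "E v = 0" "H v = scl (of_nat n) v"
     "(F ^^ Suc n) v = 0" "\<And>k. k \<le> n \<Longrightarrow> (F ^^ k) v \<noteq> 0"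
    using exists_highest_weight_vector by blast
  define u where "u k = (F ^^ k) v" for k
  define l where "l k = of_nat n - 2 * (of_nat k :: complex)" for k
  have Hu: "H (u k) = scl (l k) (u k)" for k
    unfolding u_def l_def by (rule H_F_pow[OF v(3)])
  have "inj_on l {..n}" by (auto simp: inj_on_def l_def)
  then have ind: "inj_on u {..n}" "independent (u ` {..n})"
    using eigenvectors_independent[OF linear_H, of l "{..n}" u] Hu v(5) by (auto simp: u_def)
  let ?U = "span (u ` {..n})"
  have Fu: "F (u k) \<in> ?U" if "k \<le> n" for k
  proof (cases "k = n")
    case True
    then have "F (u k) = 0" using v(4) by (simp add: u_def)
    then show ?thesis by (simp add: span_zero)
  next
    case False
    then have "F (u k) = u (Suc k)" "Suc k \<le> n" using that by (simp_all add: u_def)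
    then show ?thesis by (auto intro!: span_base)
  qed
  have Eu: "E (u k) \<in> ?U" if "k \<le> n" for k
  proof (cases k)
    case 0
    then show ?thesis using v by (simp add: u_def span_zero)
  next
    case (Suc j)
    then have "E (u k) = scl ((of_nat j + 1) * (of_nat n - of_nat j)) (u j)"
      unfolding u_def using E_F_pow[OF v(2,3), of j] by simp
    moreover have "u j \<in> ?U" using that Suc by (intro span_base) auto
    ultimately show ?thesis by (simp add: span_scale)
  qed
  have Hu': "H (u k) \<in> ?U" if "k \<le> n" for k
    unfolding Hu using that by (intro span_scale span_base) auto
  have closed: "T x \<in> ?U"
    if T: "Vector_Spaces.linear scl scl T" "\<And>k. k \<le> n \<Longrightarrow> T (u k) \<in> ?U" and x: "x \<in> ?U" for T x
  proof -
    interpret T: Vector_Spaces.linear scl scl T by (rule T)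
    show ?thesis using x
      by (induction rule: span_induct_alt)
        (auto simp: T.zero T.add T.scale span_zero intro!: span_add span_scale T(2))
  qed
  have "invariant ?U"
    unfolding invariant_def
    using closed[OF linear_E Eu] closed[OF linear_F Fu] closed[OF linear_H Hu'] by auto
  moreover have "?U \<subseteq> V"
    using inv pow_mem(2)[OF inv v(1)]
    by (intro span_minimal) (auto simp: invariant_def u_def)
  moreover have "?U \<noteq> {0}"
  proof -
    have "u 0 \<in> ?U" by (intro span_base) simp
    then show ?thesis using v(5)[of 0] by (auto simp: u_def)
  qed
  ultimately have U: "?U = V" using V by (auto simp: irreducible_def)
  have "dim V = card (u ` {..n})" unfolding U[symmetric] using ind(2) by (rule dim_span_eq_card_independent)
  then have dim: "dim V = n + 1" by (simp add: card_image ind(1))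
  have "\<exists>c. x = (\<Sum>k\<le>n. scl (c k) ((F ^^ k) v))" if "x \<in> V" for x
  proof -
    from that have "x \<in> ?U" by (simp add: U)
    then obtain c where "x = (\<Sum>w\<in>u ` {..n}. scl (c w) w)"
      unfolding span_finite[OF finite_imageI[OF finite_atMost]] by blast
    then have "x = (\<Sum>k\<le>n. scl (c (u k)) (u k))" by (simp add: sum.reindex[OF ind(1)])
    then show ?thesis unfolding u_def by (intro exI[of _ "\<lambda>k. c ((F ^^ k) v)"])
  qed
  then show ?thesis using v v(5)[of 0] dim by (intro exI[of _ v] exI[of _ n]) auto
qed

text \<open>Twice the operator EF + FE + H^2 / 2, written with \<open>E\<close> applied first. On a
  highest weight vector of weight n only H^2 + 2 H survives, which gives n (n + 2).\<close>

definition casimir :: "'a \<Rightarrow> 'a" where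
  "casimir x = scl 4 (F (E x)) + H (H x) + scl 2 (H x)"

lemma linear_casimir: "Vector_Spaces.linear scl scl casimir"
  unfolding casimir_def
  by (intro Vector_Spaces.linear_iff[THEN iffD2] conjI vector_space_axioms)
    (simp_all add: op_simps algebra_simps)

lemma casimir_commute:
  "casimir (E x) = E (casimir x)" "casimir (F x) = F (casimir x)" "casimir (H x) = H (casimir x)"
  unfolding casimir_def
  by (simp_all add: op_simps algebra_simps flip: scale_left_distrib)

lemma casimir_highest_weight:
  assumes "E v = 0" "H v = scl (of_nat n) v"
  shows "casimir ((F ^^ k) v) = scl (of_nat (n * (n + 2))) ((F ^^ k) v)"
proof -
  have "casimir ((F ^^ k) v) = (F ^^ k) (casimir v)"
    by (induction k) (simp_all add: casimir_commute)
  also have "casimir v = scl (of_nat (n * (n + 2))) v"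
    using assms by (simp add: casimir_def op_simps algebra_simps)
  also have "(F ^^ k) (scl (of_nat (n * (n + 2))) v) = scl (of_nat (n * (n + 2))) ((F ^^ k) v)"
    by (induction k) (simp_all add: F.scale)
  finally show ?thesis .
qed

text \<open>On an invariant line the operators are commuting scalars, so the relations make them
  zero. The same holds on the quotient by the line, so the operators map \<open>W\<close> into
  \<open>U\<close>, where they all vanish. Hence products of two operators are zero on
  \<open>W\<close>, and so are their commutators, which are nonzero multiples of \<open>H\<close>,
  \<open>E\<close> and \<open>F\<close>.\<close>

lemma reducible_plane_trivial:
  assumes W: "invariant W" "W \<noteq> {0}" "W \<subseteq> span {a, b}" and red: "\<not> irreducible W"
    and x: "x \<in> W"
  shows "E x = 0" "F x = 0" "H x = 0"
proof -
  obtain U where U: "invariant U" "U \<subseteq> W" "U \<noteq> {0}" "U \<noteq> W"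
    using W red by (auto simp: irreducible_def)
  have sU: "subspace U" and sW: "subspace W" using U W by (auto simp: invariant_def)
  obtain u where u: "u \<in> U" "u \<noteq> 0" using U subspace_0[OF sU] by blast
  obtain w where w: "w \<in> W" "w \<notin> U" using U by blast
  have fill: "W \<subseteq> span {p, q}" if pq: "p \<in> W" "q \<in> W" "q \<noteq> 0" "p \<notin> span {q}" for p q
  proof -
    have "dim W \<le> card {a, b}" using W(3) by (rule dim_le_card) simp
    also have "\<dots> \<le> 2" by (simp add: card_insert_if)
    also have "2 = card {p, q}" using pq(4) by (auto simp: card_insert_if span_base)
    finally have "dim W \<le> card {p, q}" .
    moreover have "independent {p, q}"
      using pq by (simp add: independent_insert)
    ultimately show ?thesis using pq by (intro card_ge_dim_independent) auto
  qed
  have Uu: "p \<in> span {u}" if "p \<in> U" for p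
  proof (rule ccontr)
    assume "p \<notin> span {u}"
    then have "W \<subseteq> span {p, u}" using fill[of p u] that u U(2) by blast
    also have "\<dots> \<subseteq> U" using that u by (intro span_minimal sU) auto
    finally show False using U by blast
  qed
  have ex: "\<exists>c. p = scl c u" if "p \<in> U" for p
    using Uu[OF that] by (auto simp: span_singleton)
  obtain e f h where efh: "E u = scl e u" "F u = scl f u" "H u = scl h u"
    using U(1) u ex by (metis invariant_def)
  have "H u = 0"
    using E_F[of u] by (simp add: efh E.scale F.scale mult.commute)
  moreover from this have "E u = 0"
    using E_H[of u] by (simp add: efh(1) E.zero H.scale)
  moreover have "F u = 0"
    using H_F[of u] \<open>H u = 0\<close> by (simp add: efh(2) F.zero H.scale)
  ultimately have U0: "E p = 0" "F p = 0" "H p = 0" if "p \<in> U" for p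
    using ex[OF that] by (auto simp: E.scale F.scale H.scale)
  have "span {u} \<subseteq> U" using u sU by (intro span_minimal) auto
  then have dec: "\<exists>c. y - scl c w \<in> U" if "y \<in> W" for y
    using fill[OF w(1), of u] u U(2) w(2) that span_breakdown_eq[of y w "{u}"] by blast
  have shape: "\<exists>c p. y = scl c w + p \<and> p \<in> U" if "y \<in> W" for y
    using dec[OF that] by (metis add.commute diff_add_cancel)
  have Ww: "E w \<in> W" "F w \<in> W" "H w \<in> W" using W(1) w by (auto simp: invariant_def)
  obtain e p where e: "E w = scl e w + p" "p \<in> U" using shape[OF Ww(1)] by blast
  obtain f q where f: "F w = scl f w + q" "q \<in> U" using shape[OF Ww(2)] by blast
  \<comment> \<open>The contributions e f w to both products cancel: modulo \<open>U\<close> the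
    operators act on \<open>w\<close> by scalars.\<close>
  have "H w = scl f p - scl e q"
    using E_F[of w] U0[OF e(2)] U0[OF f(2)]
    by (simp add: e(1) f(1) E.add F.add E.scale F.scale algebra_simps)
  then have HU: "H w \<in> U" using e f sU by (simp add: subspace_diff subspace_scale)
  have "scl 2 (E w) = scl e (H w)"
    using E_H[of w] U0[OF HU] U0[OF e(2)] by (simp add: e(1) H.add H.scale)
  then have "scl (1/2) (scl 2 (E w)) \<in> U" using HU sU by (simp add: subspace_scale)
  then have EU: "E w \<in> U" by simp
  have "H (F w) = scl f (H w)"
    unfolding f(1) H.add H.scale U0(3)[OF f(2)] by simp
  then have "scl 2 (F w) = - scl f (H w)"
    using H_F[of w] U0(2)[OF HU] by (metis diff_0 minus_minus)
  then have "scl (1/2) (scl 2 (F w)) \<in> U" using HU sU by (metis subspace_neg subspace_scale)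
  then have FU: "F w \<in> U" by simp
  have w0: "H w = 0" using E_F[of w] U0[OF EU] U0[OF FU] by simp
  have "E w = 0" using E_H[of w] U0[OF EU] by (simp add: w0 E.zero)
  moreover have "F w = 0" using H_F[of w] U0[OF FU] by (simp add: w0 F.zero)
  moreover obtain c p where "x = scl c w + p" "p \<in> U" using shape[OF x] by blast
  ultimately show "E x = 0" "F x = 0" "H x = 0"
    using w0 U0[of p] by (simp_all add: E.add F.add H.add E.scale F.scale H.scale)
qed

text \<open>Modulo \<open>W\<close>, the vector \<open>x0\<close> generates the adjoint module, on which the Casimir
  operator is 8. If it is a different scalar on \<open>W\<close>, subtracting that scalar projects away from
  \<open>W\<close>. Otherwise \<open>n = 2\<close>, and \<open>H (H + 2) / 8\<close> moves \<open>x0\<close> into the generalised weight space 2.\<close>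

lemma weight_two_lift:
  assumes W: "invariant W"
    and cas: "\<And>w. w \<in> W \<Longrightarrow> casimir w = scl (of_nat (n * (n + 2))) w"
    and wts: "\<And>w. n = 2 \<Longrightarrow> w \<in> W \<Longrightarrow> H (H (H w)) = scl 4 (H w)"
    and x0: "E x0 \<in> W" "H x0 - scl 2 x0 \<in> W" "F (F (F x0)) \<in> W"
  shows "\<exists>x. x - x0 \<in> W \<and> E x = 0 \<and> H x = scl 2 x \<and> F (F (F x)) = 0"
proof -
  have sW: "subspace W" using W by (simp add: invariant_def)
  note sub = subspace_add[OF sW] subspace_diff[OF sW] subspace_scale[OF sW] subspace_neg[OF sW]
  have inv: "E w \<in> W" "F w \<in> W" "H w \<in> W" if "w \<in> W" for w
    using W that by (auto simp: invariant_def)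
  interpret C: Vector_Spaces.linear scl scl casimir by (rule linear_casimir)
  define i where "i = H x0 - scl 2 x0"
  have i: "i \<in> W" "H x0 = scl 2 x0 + i" using x0(2) by (simp_all add: i_def)
  show ?thesis
  proof (cases "n = 2")
    case False
    define c :: complex where "c = of_nat (n * (n + 2))"
    have "n * (n + 2) \<noteq> 8"
    proof -
      have "n \<le> 1 \<or> n \<ge> 3" using False by auto
      moreover have "n * (n + 2) \<ge> 3 * 5" if "n \<ge> 3" using that by (intro mult_mono) auto
      ultimately show ?thesis by (auto simp: le_Suc_eq)
    qed
    then have "c \<noteq> 8" unfolding c_def by (metis of_nat_eq_iff of_nat_numeral)
    define x where "x = scl (1 / (8 - c)) (casimir x0 - scl c x0)"
    have kill: "casimir w - scl c w = 0" if "w \<in> W" for w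
      using cas[OF that] by (simp add: c_def)
    have "casimir x0 - scl 8 x0 = scl 4 (F (E x0)) + H i + scl 4 i"
      unfolding casimir_def i(2) H.add H.scale by (simp add: i(2) algebra_simps scale_left_distrib[symmetric])
    then have "casimir x0 - scl 8 x0 \<in> W"
      using x0(1) i(1) by (simp add: sub inv)
    then have "scl (1 / (8 - c)) (casimir x0 - scl 8 x0) \<in> W" by (rule sub)
    moreover have "scl (1 / (8 - c)) (casimir x0 - scl 8 x0) = x - x0"
    proof -
      have "scl (8 - c) x = casimir x0 - scl c x0"
        using \<open>c \<noteq> 8\<close> by (simp add: x_def)
      then have "scl (8 - c) (x - x0) = casimir x0 - scl 8 x0"
        by (simp add: scale_right_diff_distrib scale_left_diff_distrib)
      then have "scl (1 / (8 - c)) (casimir x0 - scl 8 x0) = scl (1 / (8 - c)) (scl (8 - c) (x - x0))"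
        by simp
      also have "\<dots> = x - x0" using \<open>c \<noteq> 8\<close> by simp
      finally show ?thesis .
    qed
    moreover have "E x = 0" using kill[OF x0(1)]
      by (simp add: x_def E.scale E.diff casimir_commute[symmetric])
    moreover have "F (F (F x)) = 0" using kill[OF x0(3)]
      by (simp add: x_def F.scale F.diff casimir_commute[symmetric])
    moreover have "H x - scl 2 x = 0"
    proof -
      have "H x - scl 2 x = scl (1 / (8 - c)) (casimir i - scl c i)"
        by (simp add: x_def i_def H.scale H.diff casimir_commute[symmetric] C.diff C.scale algebra_simps)
      then show ?thesis using kill[OF i(1)] by simp
    qed
    ultimately show ?thesis by (intro exI[of _ x]) simp
  next
    case True
    note cubic = wts[OF True]
    \<comment> \<open>The polynomial t (t + 2) / 8 is 1 at 2 and 0 at the other adjoint weights 0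
      and -2. Its product with t - 2 is a multiple of t^3 - 4 t, which annihilates \<open>H\<close>
      on \<open>W\<close>.\<close>
    define x where "x = scl (1/8) (H (H x0) + scl 2 (H x0))"
    have "H (H x0) + scl 2 (H x0) = scl 8 x0 + (H i + scl 4 i)"
      by (simp add: i(2) H.add H.scale algebra_simps scale_left_distrib[symmetric])
    then have "x = x0 + scl (1/8) (H i + scl 4 i)" by (simp add: x_def scale_right_distrib)
    then have x: "x - x0 \<in> W" using i(1) by (simp add: sub inv)
    \<comment> \<open>The possible nilpotent part of \<open>H\<close> at \<open>x\<close>. It is
      itself a weight vector of weight 2 in \<open>W\<close>.\<close>
    define w where "w = H x - scl 2 x"
    have w_eq: "w = scl (1/8) (H (H i) + scl 2 (H i))"
      by (simp add: w_def x_def i_def H.add H.scale H.diff algebra_simps)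
    then have wW: "w \<in> W" using i(1) by (simp add: sub inv)
    have Hw: "H w = scl 2 w"
      using cubic[OF i(1)] by (simp add: w_eq H.add H.scale algebra_simps)
    have Hx: "H x = scl 2 x + w" by (simp add: w_def)
    \<comment> \<open>The condition on d says that d is none of the weights 0, 2, -2 of
      \<open>W\<close>; it is used for the weights 4 and -4.\<close>
    have eig0: "y = 0" if "y \<in> W" "H y = scl d y" "d^3 \<noteq> 4 * d" for y d
    proof -
      have "scl (d^3) y = scl (4 * d) y"
        using cubic[OF that(1)] by (simp add: that(2) H.scale power3_eq_cube)
      then show ?thesis using that(3) by simp
    qed
    have Ew: "E w = 0"
      by (rule eig0[of _ 4]) (simp_all add: inv wW H_E Hw E.scale scale_left_distrib[symmetric])
    have FFFw: "F (F (F w)) = 0"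
      by (rule eig0[of _ "-4"])
        (simp_all add: inv wW H_F Hw F.scale F.diff scale_left_diff_distrib[symmetric] scale_minus_left[symmetric] del: scale_minus_left)
    have "E x \<in> W"
    proof -
      have "E x = E x0 + E (x - x0)" by (simp add: E.diff)
      then show ?thesis using x x0(1) by (simp add: sub inv)
    qed
    moreover have "H (E x) = scl 4 (E x)"
      by (simp add: H_E Hx E.add E.scale Ew scale_left_distrib[symmetric])
    ultimately have Ex: "E x = 0" by (rule eig0) simp
    have "F (F (F x)) \<in> W"
    proof -
      have "F (F (F x)) = F (F (F x0)) + F (F (F (x - x0)))" by (simp add: F.diff)
      then show ?thesis using x x0(3) by (simp add: sub inv)
    qed
    moreover have "H (F (F (F x))) = scl (-4) (F (F (F x)))"
      by (simp add: H_F Hx F.add F.scale F.diff FFFw scale_left_diff_distrib[symmetric] scale_minus_left[symmetric] del: scale_minus_left)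
    ultimately have FFFx: "F (F (F x)) = 0" by (rule eig0) simp
    \<comment> \<open>For a true highest weight vector of weight 2 the coefficient (k + 1) (2 - k)
      of \<open>E_F_pow\<close> is zero at k = 2. Here each of the three interchanges of
      \<open>E\<close> with \<open>F\<close> contributes one further summand
      \<open>F (F w)\<close>.\<close>
    have "scl 3 y = y + (y + y)" for y
      using scale_left_distrib[of 1 2 y] scale_left_distrib[of 1 1 y] by simp
    then have "E (F (F (F x))) = scl 3 (F (F w))"
      by (simp add: op_simps Ex Hx algebra_simps scale_left_distrib[symmetric])
    then have FFw: "F (F w) = 0" using FFFx by (simp add: E.zero)
    \<comment> \<open>Here 4 = 2 times 2, the two coefficients of \<open>E_F_pow\<close> for weight
      2 on the way back from \<open>F (F w)\<close> to \<open>w\<close>.\<close>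
    have "E (E (F (F w))) = scl 4 w"
      by (simp add: op_simps Ew Hw algebra_simps scale_left_distrib[symmetric])
    then have "w = 0" using FFw by (simp add: E.zero)
    then show ?thesis using x Ex FFFx Hx by (intro exI[of _ x]) simp
  qed
qed

end

subsection \<open>Leibniz algebras over a sum of two copies of sl2\<close>

definition mat_scale :: "complex \<Rightarrow> complex^2^2 \<Rightarrow> complex^2^2" where
  "mat_scale c A = (\<chi> i j. c * A $ i $ j)"

definition commutator :: "complex^2^2 \<Rightarrow> complex^2^2 \<Rightarrow> complex^2^2" where
  "commutator A B = A ** B - B ** A"

definition mat_e :: "complex^2^2" where "mat_e = vector [vector [0, 1], vector [0, 0]]"
definition mat_f :: "complex^2^2" where "mat_f = vector [vector [0, 0], vector [1, 0]]"
definition mat_h :: "complex^2^2" where "mat_h = vector [vector [1, 0], vector [0, -1]]"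

lemmas mat2_simps = vec_eq_iff forall_2 sum_2 matrix_matrix_mult_def trace_def commutator_def
  mat_scale_def mat_e_def mat_f_def mat_h_def

lemma commutator_mat_basis:
  "commutator mat_e mat_f = mat_h"
  "commutator mat_h mat_e = mat_scale 2 mat_e"
  "commutator mat_f mat_h = mat_scale 2 mat_f"
  "commutator mat_f mat_e = mat_scale (-1) mat_h"
  by (simp_all add: mat2_simps)

lemma commutator_zero [simp]: "commutator A 0 = 0" "commutator 0 A = 0" "commutator A A = 0"
  by (simp_all add: commutator_def)

lemma commutator_scale: "commutator (mat_scale c A) B = mat_scale c (commutator A B)"
  by (simp add: mat2_simps algebra_simps)

lemma mat_scale_zero [simp]: "mat_scale c 0 = 0"
  by (simp add: mat2_simps)

lemma trace_mat_basis [simp]: "trace mat_e = 0" "trace mat_f = 0" "trace mat_h = 0" "trace (0 :: complex^2^2) = 0"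
  by (simp_all add: mat2_simps)

lemma traceless_decomp:
  assumes "trace A = 0"
  obtains a b c where "A = mat_scale a mat_f + mat_scale b mat_e + mat_scale c mat_h"
proof
  from assms have "A $ 2 $ 2 = - (A $ 1 $ 1)"
    by (simp add: trace_def sum_2 eq_neg_iff_add_eq_0 add.commute)
  then show "A = mat_scale (A $ 2 $ 1) mat_f + mat_scale (A $ 1 $ 2) mat_e + mat_scale (A $ 1 $ 1) mat_h"
    by (simp add: mat2_simps)
qed

lemma mat_basis_independent:
  assumes "mat_scale a mat_f + mat_scale b mat_e + mat_scale c mat_h = 0"
  shows "a = 0" "b = 0" "c = 0"
  using assms by (simp_all add: mat2_simps)

lemma (in sl2_triple) weight_two_invariant:
  assumes "E x = 0" "H x = scl 2 x" "F (F (F x)) = 0"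
  shows "invariant (span {x, F x, F (F x)})"
proof -
  let ?S = "span {x, F x, F (F x)}"
  have mem: "x \<in> ?S" "F x \<in> ?S" "F (F x) \<in> ?S" by (auto intro: span_base)
  have "E x \<in> ?S" "E (F x) \<in> ?S" "E (F (F x)) \<in> ?S" "F (F (F x)) \<in> ?S"
    "H x \<in> ?S" "H (F x) \<in> ?S" "H (F (F x)) \<in> ?S"
    using assms by (simp_all add: op_simps mem span_add span_diff span_neg span_scale span_zero)
  moreover have "T s \<in> ?S" if T: "Vector_Spaces.linear scl scl T"
    "T x \<in> ?S" "T (F x) \<in> ?S" "T (F (F x)) \<in> ?S" and s: "s \<in> ?S" for T s
  proof -
    interpret T: Vector_Spaces.linear scl scl T by (rule T)
    show ?thesis using s
    proof (induction rule: span_induct_alt)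
      case base
      then show ?case by (simp add: T.zero span_zero)
    next
      case (step c u w)
      then show ?case using T(2-4) by (auto simp: T.add T.scale span_add span_scale)
    qed
  qed
  ultimately show ?thesis
    unfolding invariant_def using mem linear_E linear_F linear_H by auto
qed

lemma (in vector_space) span_three:
  assumes "s \<in> span {x, y, z}"
  obtains a b c where "s = scale a x + scale b y + scale c z"
proof -
  obtain a where "s - scale a x \<in> span {y, z}" using assms span_breakdown_eq[of s x "{y, z}"] by blast
  then obtain b where "s - scale a x - scale b y \<in> span {z}"
    using span_breakdown_eq[of _ y "{z}"] by blast
  then obtain c where "s - scale a x - scale b y = scale c z" by (auto simp: span_singleton)
  then have "s = scale a x + scale b y + scale c z" by (simp add: algebra_simps)
  then show ?thesis by (rule that)
qed

text \<open>The maps \<open>p\<close> and \<open>q\<close> are the two components of the projection of \<open>L\<close> onto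
  \<open>L/I\<close>, identified with the direct sum of two copies of \<open>sl2\<close>.\<close>

locale leibniz_over_sl2_sl2 = leibniz_algebra scl br + finite_dimensional_vector_space scl B
  for scl :: "complex \<Rightarrow> 'a::ab_group_add \<Rightarrow> 'a" and br B +
  fixes I :: "'a set" and p q :: "'a \<Rightarrow> complex^2^2"
  assumes p_add: "p (x + y) = p x + p y" and q_add: "q (x + y) = q x + q y"
    and p_scale: "p (scl c x) = mat_scale c (p x)" and q_scale: "q (scl c x) = mat_scale c (q x)"
    and p_br: "p (br x y) = commutator (p x) (p y)" and q_br: "q (br x y) = commutator (q x) (q y)"
    and trace_p: "trace (p x) = 0" and trace_q: "trace (q x) = 0"
    and pq_surj: "trace A = 0 \<Longrightarrow> trace C = 0 \<Longrightarrow> \<exists>x. p x = A \<and> q x = C"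
    and kernel: "p x = 0 \<and> q x = 0 \<longleftrightarrow> x \<in> I"
    and br_kernel: "y \<in> I \<Longrightarrow> br x y = 0"
begin

section \<open>Right multiplication as a module structure over \<open>L/I\<close>\<close>

sublocale left: Vector_Spaces.linear scl scl "\<lambda>x. br x y" for y by (rule linear_left)
sublocale right: Vector_Spaces.linear scl scl "\<lambda>y. br x y" for x by (rule linear_right)

lemma p_zero [simp]: "p 0 = 0" using p_add[of 0 0] by simp
lemma q_zero [simp]: "q 0 = 0" using q_add[of 0 0] by simp
lemma p_diff: "p (x - y) = p x - p y" using p_add[of "x - y" y] by simp
lemma q_diff: "q (x - y) = q x - q y" using q_add[of "x - y" y] by simp

lemmas pq_simps = p_add q_add p_diff q_diff p_scale q_scale p_br q_br

lemma kernelI: "p x = 0 \<Longrightarrow> q x = 0 \<Longrightarrow> x \<in> I"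
  using kernel by blast

lemma subspace_kernel: "subspace I"
  by (rule subspaceI) (simp_all add: kernel[symmetric] pq_simps)

lemma br_mem: "x \<in> I \<Longrightarrow> br x y \<in> I"
  by (simp add: kernel[symmetric] pq_simps)

text \<open>This makes right multiplication by a class of \<open>L/I\<close> well defined.\<close>

lemma br_cong:
  assumes "p y = p z" "q y = q z"
  shows "br x y = br x z"
proof -
  have "br x (y - z) = 0" using assms by (intro br_kernel kernelI) (simp_all add: pq_simps)
  then show ?thesis by (simp add: right.diff)
qed

text \<open>An arbitrary preimage. By \<open>br_cong\<close>, \<open>br x (lift A C)\<close> does
  not depend on the choice.\<close>

definition lift :: "complex^2^2 \<Rightarrow> complex^2^2 \<Rightarrow> 'a" where
  "lift A C = (SOME x. p x = A \<and> q x = C)"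

lemma lift:
  assumes "trace A = 0" "trace C = 0"
  shows "p (lift A C) = A" "q (lift A C) = C"
  using someI_ex[OF pq_surj[OF assms]] by (auto simp: lift_def)

text \<open>Right multiplication is an anti-representation; exchanging \<open>e\<close> and \<open>f\<close>
  turns it into an \<open>sl2\<close>-triple.\<close>

lemma right_mult_triple:
  assumes "p (br e f) = p h" "q (br e f) = q h"
    "p (br h e) = p (scl 2 e)" "q (br h e) = q (scl 2 e)"
    "p (br f h) = p (scl 2 f)" "q (br f h) = q (scl 2 f)"
  shows "sl2_triple scl B (\<lambda>x. br x f) (\<lambda>x. br x e) (\<lambda>x. br x h)"
proof
  fix x
  have "br x (br e f) = br x h" by (rule br_cong[OF assms(1,2)])
  then show "br (br x e) f = br (br x f) e + br x h"
    using leibniz_identity[of x e f] by (simp add: algebra_simps)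
  have "br x (br f h) = br x (scl 2 f)" by (rule br_cong[OF assms(5,6)])
  then show "br (br x h) f = br (br x f) h - scl 2 (br x f)"
    using leibniz_identity[of x f h] by (simp add: right.scale algebra_simps)
  have "br x (br h e) = br x (scl 2 e)" by (rule br_cong[OF assms(3,4)])
  then show "br (br x e) h = br (br x h) e - scl 2 (br x e)"
    using leibniz_identity[of x h e] by (simp add: right.scale algebra_simps)
qed

abbreviation "E1 x \<equiv> br x (lift mat_f 0)"
abbreviation "F1 x \<equiv> br x (lift mat_e 0)"
abbreviation "H1 x \<equiv> br x (lift mat_h 0)"
abbreviation "E2 x \<equiv> br x (lift 0 mat_f)"
abbreviation "F2 x \<equiv> br x (lift 0 mat_e)"
abbreviation "H2 x \<equiv> br x (lift 0 mat_h)"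

sublocale T1: sl2_triple scl B E1 F1 H1
  by (rule right_mult_triple) (simp_all add: pq_simps lift commutator_mat_basis)

sublocale T2: sl2_triple scl B E2 F2 H2
  by (rule right_mult_triple) (simp_all add: pq_simps lift commutator_mat_basis)

text \<open>The bracket of elements over different factors lies in \<open>I\<close>, and right
  multiplication by \<open>I\<close> is zero.\<close>

lemma br_br_commute:
  assumes "q a = 0" "p b = 0"
  shows "br (br x a) b = br (br x b) a"
proof -
  have "br x (br a b) = 0" using assms by (intro br_kernel kernelI) (simp_all add: pq_simps)
  then show ?thesis using leibniz_identity[of x a b] by simp
qed

lemma br_factor1:
  assumes "q b = 0"
  obtains \<alpha> \<beta> \<gamma> where "\<And>x. br x b = scl \<alpha> (E1 x) + scl \<beta> (F1 x) + scl \<gamma> (H1 x)"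
proof -
  obtain \<alpha> \<beta> \<gamma> where "p b = mat_scale \<alpha> mat_f + mat_scale \<beta> mat_e + mat_scale \<gamma> mat_h"
    using traceless_decomp[OF trace_p] by blast
  then have "br x b = br x (scl \<alpha> (lift mat_f 0) + scl \<beta> (lift mat_e 0) + scl \<gamma> (lift mat_h 0))" for x
    using assms by (intro br_cong) (simp_all add: pq_simps lift)
  then show ?thesis by (intro that) (simp add: right.add right.scale)
qed

lemma br_factor2:
  assumes "p b = 0"
  obtains \<alpha> \<beta> \<gamma> where "\<And>x. br x b = scl \<alpha> (E2 x) + scl \<beta> (F2 x) + scl \<gamma> (H2 x)"
proof -
  obtain \<alpha> \<beta> \<gamma> where "q b = mat_scale \<alpha> mat_f + mat_scale \<beta> mat_e + mat_scale \<gamma> mat_h"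
    using traceless_decomp[OF trace_q] by blast
  then have "br x b = br x (scl \<alpha> (lift 0 mat_f) + scl \<beta> (lift 0 mat_e) + scl \<gamma> (lift 0 mat_h))" for x
    using assms by (intro br_cong) (simp_all add: pq_simps lift)
  then show ?thesis by (intro that) (simp add: right.add right.scale)
qed

lemma br_split: "br x b = br x (lift (p b) 0) + br x (lift 0 (q b))"
  unfolding right.add[symmetric]
  by (rule br_cong) (simp_all add: pq_simps lift trace_p trace_q)

text \<open>Frees invariance from the chosen basis of \<open>sl2\<close>, as needed for comparison
  with submodules.\<close>

lemma invariant1_iff:
  "T1.invariant W \<longleftrightarrow> subspace W \<and> (\<forall>w\<in>W. \<forall>b. q b = 0 \<longrightarrow> br w b \<in> W)"
proof
  assume W: "T1.invariant W"
  then have sW: "subspace W" by (simp add: T1.invariant_def)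
  show "subspace W \<and> (\<forall>w\<in>W. \<forall>b. q b = 0 \<longrightarrow> br w b \<in> W)"
  proof (intro conjI ballI allI impI sW)
    fix w b assume "w \<in> W" "q b = 0"
    then show "br w b \<in> W" using W
      by (elim br_factor1) (auto simp: T1.invariant_def intro!: subspace_add subspace_scale)
  qed
qed (auto simp: T1.invariant_def lift)

lemma invariant2_iff:
  "T2.invariant W \<longleftrightarrow> subspace W \<and> (\<forall>w\<in>W. \<forall>b. p b = 0 \<longrightarrow> br w b \<in> W)"
proof
  assume W: "T2.invariant W"
  then have sW: "subspace W" by (simp add: T2.invariant_def)
  show "subspace W \<and> (\<forall>w\<in>W. \<forall>b. p b = 0 \<longrightarrow> br w b \<in> W)"
  proof (intro conjI ballI allI impI sW)
    fix w b assume "w \<in> W" "p b = 0"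
    then show "br w b \<in> W" using W
      by (elim br_factor2) (auto simp: T2.invariant_def intro!: subspace_add subspace_scale)
  qed
qed (auto simp: T2.invariant_def lift)

section \<open>Levi complements when the second copy annihilates \<open>I\<close>\<close>

lemma invariant_kernel: "T1.invariant I" "T2.invariant I"
  by (auto simp: invariant1_iff invariant2_iff subspace_kernel br_mem)

text \<open>The second copy maps \<open>x\<close> into \<open>I\<close> and annihilates
  \<open>I\<close>, so every product of two of its operators is zero at \<open>x\<close>. The
  relations express each single operator by such products.\<close>

lemma factor2_kills:
  assumes triv: "\<And>x b. x \<in> I \<Longrightarrow> p b = 0 \<Longrightarrow> br x b = 0"
    and x: "q x = 0" and b: "p b = 0"
  shows "br x b = 0"
proof -
  have mem: "br x c \<in> I" if "p c = 0" for c
    using x that by (intro kernelI) (simp_all add: pq_simps)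
  have kill: "br (br x c) d = 0" if "p c = 0" "p d = 0" for c d
    using mem triv that by blast
  have "H2 x = 0" using T2.E_F[of x] by (simp add: kill lift)
  moreover have "E2 x = 0" using T2.E_H[of x] by (simp add: kill lift)
  moreover have "F2 x = 0" using T2.H_F[of x] by (simp add: kill lift)
  ultimately show ?thesis using br_factor2[OF b] by (metis add_0 scale_zero_right)
qed

lemma levi_complement_exists:
  assumes triv: "\<And>x b. x \<in> I \<Longrightarrow> p b = 0 \<Longrightarrow> br x b = 0"
    and cas: "\<And>w. w \<in> I \<Longrightarrow> T1.casimir w = scl (of_nat (n * (n + 2))) w"
    and wts: "\<And>w. n = 2 \<Longrightarrow> w \<in> I \<Longrightarrow> H1 (H1 (H1 w)) = scl 4 (H1 w)"
  shows "\<exists>S. levi_complement scl br I S"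
proof -
  let ?x0 = "lift mat_f 0" and ?y0 = "lift 0 mat_f"
  have triv2: "E2 w = 0" "F2 w = 0" "H2 w = 0" if "w \<in> I" for w
    using that by (simp_all add: triv lift)
  have "\<exists>x. x - ?x0 \<in> I \<and> E1 x = 0 \<and> H1 x = scl 2 x \<and> F1 (F1 (F1 x)) = 0"
    by (rule T1.weight_two_lift[OF invariant_kernel(1) cas wts])
      (auto intro!: kernelI simp: pq_simps lift commutator_mat_basis commutator_scale)
  then obtain x where x: "x - ?x0 \<in> I" "E1 x = 0" "H1 x = scl 2 x" "F1 (F1 (F1 x)) = 0" by blast
  \<comment> \<open>Over the second copy \<open>I\<close> is trivial, so its Casimir eigenvalue
    there is the one for n = 0.\<close>
  have "\<exists>y. y - ?y0 \<in> I \<and> E2 y = 0 \<and> H2 y = scl 2 y \<and> F2 (F2 (F2 y)) = 0"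
    by (rule T2.weight_two_lift[OF invariant_kernel(2), of 0])
      (auto intro!: kernelI simp: pq_simps lift commutator_mat_basis commutator_scale
        T2.casimir_def triv2)
  then obtain y where y: "y - ?y0 \<in> I" "E2 y = 0" "H2 y = scl 2 y" "F2 (F2 (F2 y)) = 0" by blast
  have px: "p x = mat_f" "q x = 0"
    using x(1) by (simp_all add: kernel[symmetric] pq_simps lift)
  have py: "p y = 0" "q y = mat_f"
    using y(1) by (simp_all add: kernel[symmetric] pq_simps lift)
  let ?U = "span {x, F1 x, F1 (F1 x)}" and ?V = "span {y, F2 y, F2 (F2 y)}"
  have U: "T1.invariant ?U" by (rule T1.weight_two_invariant[OF x(2-4)])
  have V: "T2.invariant ?V" by (rule T2.weight_two_invariant[OF y(2-4)])
  have U2: "br u b = 0" if "u \<in> ?U" "p b = 0" for u b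
  proof (rule factor2_kills[OF triv _ that(2)])
    show "q u = 0" using that(1)
      by (elim span_three) (simp add: pq_simps px lift)
  qed
  \<comment> \<open>The argument of \<open>factor2_kills\<close> fails here, since the first copy
    may act nontrivially on \<open>I\<close>. Instead, \<open>H2\<close> commutes with right
    multiplication by \<open>b\<close>, so \<open>br y b\<close> has weight 2 like \<open>y\<close>;
    but it lies in \<open>I\<close>, where \<open>H2\<close> is zero.\<close>
  have yb: "br y b = 0" if "q b = 0" for b
  proof -
    have I: "br y b \<in> I" using that by (intro kernelI) (simp_all add: pq_simps py)
    have "scl 2 (br y b) = br (H2 y) b" by (simp add: y(3) left.scale)
    also have "\<dots> = H2 (br y b)" using that by (intro br_br_commute[symmetric]) (simp_all add: lift)
    also have "\<dots> = 0" by (rule triv2(3)[OF I])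
    finally show ?thesis by simp
  qed
  have V1: "br v b = 0" if "v \<in> ?V" "q b = 0" for v b
  proof -
    have "br (br z (lift 0 mat_e)) b = F2 (br z b)" for z
      using that(2) by (intro br_br_commute[symmetric]) (simp_all add: lift)
    then show ?thesis using that(1)
      by (elim span_three) (simp add: left.add left.scale left.zero yb that(2))
  qed
  define S where "S = {u + v |u v. u \<in> ?U \<and> v \<in> ?V}"
  have S_add: "u + v \<in> S" if "u \<in> ?U" "v \<in> ?V" for u v
    unfolding S_def using that by auto
  have "subspace S" unfolding S_def by (intro subspace_sums subspace_span)
  moreover have "br s t \<in> S" if sS: "s \<in> S" for s t
  proof -
    obtain u v where s: "s = u + v" "u \<in> ?U" "v \<in> ?V" using sS unfolding S_def by blast
    have "br s t = br s (lift (p t) 0) + br s (lift 0 (q t))" by (rule br_split)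
    also have "\<dots> = br u (lift (p t) 0) + br v (lift 0 (q t))"
      by (simp add: s(1) left.add U2[OF s(2)] V1[OF s(3)] lift trace_p trace_q)
    finally have "br s t = br u (lift (p t) 0) + br v (lift 0 (q t))" .
    moreover have "br u (lift (p t) 0) \<in> ?U" using U s(2) by (simp add: invariant1_iff lift trace_p)
    moreover have "br v (lift 0 (q t)) \<in> ?V" using V s(3) by (simp add: invariant2_iff lift trace_q)
    ultimately show ?thesis by (simp add: S_add)
  qed
  \<comment> \<open>Since [f, e] = -h and [-h, e] = -2 e, the vectors \<open>x\<close>,
    \<open>F1 x\<close>, \<open>F1 (F1 x)\<close> project to f, -h, -2 e. Inverting these
    coefficients gives the element \<open>?s\<close> below.\<close>
  moreover have pS: "p (scl a x + scl b (F1 x) + scl c (F1 (F1 x)) + (scl a' y + scl b' (F2 y) + scl c' (F2 (F2 y))))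
      = mat_scale a mat_f + mat_scale (- 2 * c) mat_e + mat_scale (- b) mat_h" for a b c a' b' c'
    by (simp add: pq_simps px py lift commutator_mat_basis commutator_scale) (simp add: mat2_simps)
  moreover have qS: "q (scl a x + scl b (F1 x) + scl c (F1 (F1 x)) + (scl a' y + scl b' (F2 y) + scl c' (F2 (F2 y))))
      = mat_scale a' mat_f + mat_scale (- 2 * c') mat_e + mat_scale (- b') mat_h" for a b c a' b' c'
    by (simp add: pq_simps px py lift commutator_mat_basis commutator_scale) (simp add: mat2_simps)
  moreover have "S \<inter> I = {0}"
  proof -
    have "s = 0" if sSI: "s \<in> S" "s \<in> I" for s
    proof -
      obtain u v where s: "s = u + v" "u \<in> ?U" "v \<in> ?V" using sSI(1) unfolding S_def by blast
      obtain a b c where u: "u = scl a x + scl b (F1 x) + scl c (F1 (F1 x))"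
        using s(2) by (rule span_three)
      obtain a' b' c' where v: "v = scl a' y + scl b' (F2 y) + scl c' (F2 (F2 y))"
        using s(3) by (rule span_three)
      have "p s = 0" "q s = 0" using sSI(2) kernel by auto
      then have "a = 0" "- 2 * c = 0" "- b = 0" "a' = 0" "- 2 * c' = 0" "- b' = 0"
        unfolding s(1) u v pS qS by (auto dest: mat_basis_independent)
      then show ?thesis by (simp add: s(1) u v)
    qed
    moreover have "0 \<in> S" "0 \<in> I" using \<open>subspace S\<close> subspace_kernel subspace_0 by auto
    ultimately show ?thesis by blast
  qed
  moreover have "{s + i |s i. s \<in> S \<and> i \<in> I} = UNIV"
  proof -
    have "\<exists>s i. l = s + i \<and> s \<in> S \<and> i \<in> I" for l
    proof -
      obtain \<alpha> \<beta> \<gamma> where a: "p l = mat_scale \<alpha> mat_f + mat_scale \<beta> mat_e + mat_scale \<gamma> mat_h"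
        using traceless_decomp[OF trace_p] by blast
      obtain \<alpha>' \<beta>' \<gamma>' where b: "q l = mat_scale \<alpha>' mat_f + mat_scale \<beta>' mat_e + mat_scale \<gamma>' mat_h"
        using traceless_decomp[OF trace_q] by blast
      let ?s = "scl \<alpha> x + scl (- \<gamma>) (F1 x) + scl (- \<beta> / 2) (F1 (F1 x))
        + (scl \<alpha>' y + scl (- \<gamma>') (F2 y) + scl (- \<beta>' / 2) (F2 (F2 y)))"
      have "?s \<in> S"
        by (intro S_add span_add span_scale span_base) auto
      moreover have "l - ?s \<in> I"
        by (intro kernelI) (simp_all only: p_diff q_diff pS qS a b, simp_all)
      ultimately show ?thesis by (intro exI[of _ ?s] exI[of _ "l - ?s"]) simp
    qed
    then show ?thesis by blast
  qed
  ultimately show ?thesis unfolding levi_complement_def by blast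
qed

text \<open>Addition is a bijection from the product of the two subalgebras to \<open>L\<close>,
  multiplicative because mixed brackets vanish; the isomorphism is its inverse.\<close>

lemma levi_complement_splits:
  assumes triv: "\<And>x b. x \<in> I \<Longrightarrow> p b = 0 \<Longrightarrow> br x b = 0"
    and S: "levi_complement scl br I S"
  shows "alg_isomorphic (sub_alg scl br UNIV)
    (alg_sum (sub_alg scl br {x + i |x i. x \<in> {s \<in> S. q s = 0} \<and> i \<in> I})
      (sub_alg scl br {s \<in> S. p s = 0}))"
proof -
  have sS: "subspace S" and Sbr: "\<And>x y. x \<in> S \<Longrightarrow> y \<in> S \<Longrightarrow> br x y \<in> S"
    and SI: "\<And>x. x \<in> S \<Longrightarrow> x \<in> I \<Longrightarrow> x = 0"
    using S by (auto simp: levi_complement_def)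
  have dec: "\<exists>s i. l = s + i \<and> s \<in> S \<and> i \<in> I" for l
  proof -
    have "l \<in> {s + i |s i. s \<in> S \<and> i \<in> I}" using S by (simp add: levi_complement_def)
    then show ?thesis by blast
  qed
  have pi: "p i = 0" "q i = 0" if "i \<in> I" for i using that kernel by auto
  let ?A = "{x + i |x i. x \<in> {s \<in> S. q s = 0} \<and> i \<in> I}"
  \<comment> \<open>The first summand is the whole kernel of \<open>q\<close>, whatever
    \<open>S\<close> is.\<close>
  define A where "A = {x. q x = 0}"
  have A: "?A = A"
  proof
    show "?A \<subseteq> A" by (auto simp: A_def pq_simps pi)
    show "A \<subseteq> ?A"
    proof
      fix x assume "x \<in> A"
      moreover obtain s i where "x = s + i" "s \<in> S" "i \<in> I" using dec by blast
      ultimately show "x \<in> ?A" by (auto simp: A_def pq_simps pi)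
    qed
  qed
  define C where "C = {s \<in> S. p s = 0}"
  let ?g = "\<lambda>(a, c). a + c :: 'a"
  have inj: "inj_on ?g (A \<times> C)"
  proof (rule inj_onI)
    fix z z' assume z: "z \<in> A \<times> C" "z' \<in> A \<times> C" "?g z = ?g z'"
    obtain a c a' c' where ac: "z = (a, c)" "z' = (a', c')" by fastforce
    have e: "c - c' = a' - a" using z(3) by (simp add: ac algebra_simps)
    have "c - c' \<in> S" "p (c - c') = 0" using z sS by (auto simp: ac C_def pq_simps subspace_diff)
    moreover have "q (c - c') = 0" unfolding e using z by (simp add: ac A_def pq_simps)
    ultimately have "c - c' = 0" using SI kernelI by blast
    then show "z = z'" using e by (simp add: ac)
  qed
  have surj: "?g ` (A \<times> C) = UNIV"
  proof -
    have "l \<in> ?g ` (A \<times> C)" for l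
    proof -
      obtain s i where s: "lift 0 (q l) = s + i" "s \<in> S" "i \<in> I" using dec by blast
      then have "p s + p i = 0" "q s + q i = q l"
        unfolding p_add[symmetric] q_add[symmetric] s(1)[symmetric] by (simp_all add: lift trace_q)
      then have "s \<in> C" "l - s \<in> A" using s by (auto simp: C_def A_def pi pq_simps)
      then show ?thesis by (intro image_eqI[of _ _ "(l - s, s)"]) auto
    qed
    then show ?thesis by blast
  qed
  have bij: "bij_betw ?g (A \<times> C) UNIV" using inj surj by (simp add: bij_betw_def)
  have closedA: "a + a' \<in> A" "br a b \<in> A" "br b a \<in> A" "scl k a \<in> A" if "a \<in> A" "a' \<in> A" for a a' b k
    using that by (auto simp: A_def pq_simps)
  have closedC: "c + c' \<in> C" "br c c' \<in> C" "scl k c \<in> C" if "c \<in> C" "c' \<in> C" for c c' k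
    using that sS Sbr by (auto simp: C_def pq_simps subspace_add subspace_scale)
  have ac: "br a c = 0" "br c a = 0" if "a \<in> A" "c \<in> C" for a c
  proof -
    obtain s i where s: "a = s + i" "s \<in> S" "i \<in> I" using dec by blast
    have q: "q s = 0" using that s by (simp add: A_def pq_simps pi)
    have c: "c \<in> S" "p c = 0" using that by (auto simp: C_def)
    \<comment> \<open>These brackets lie in \<open>S\<close>, and both of their projections are
      zero, so they lie in \<open>I\<close> too.\<close>
    have "br s c = 0" "br c s = 0"
      using q c s by (auto intro!: SI Sbr kernelI simp: pq_simps)
    then show "br a c = 0" "br c a = 0"
      using c s by (simp_all add: left.add right.add triv br_kernel)
  qed
  define f where "f = the_inv_into (A \<times> C) ?g"
  have fg: "f (a + c) = (a, c)" if "a \<in> A" "c \<in> C" for a c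
    using the_inv_into_f_f[OF inj, of "(a, c)"] that by (simp add: f_def)
  have ex: "\<exists>a c. l = a + c \<and> a \<in> A \<and> c \<in> C" for l
  proof -
    have "l \<in> ?g ` (A \<times> C)" using surj by simp
    then show ?thesis by auto
  qed
  have "bij_betw f UNIV (A \<times> C)" unfolding f_def by (rule bij_betw_the_inv_into[OF bij])
  moreover have "f (l + l') = (fst (f l) + fst (f l'), snd (f l) + snd (f l')) \<and>
      f (br l l') = (br (fst (f l)) (fst (f l')), br (snd (f l)) (snd (f l')))" for l l'
  proof -
    obtain a c a' c' where l: "l = a + c" "a \<in> A" "c \<in> C" "l' = a' + c'" "a' \<in> A" "c' \<in> C"
      using ex[of l] ex[of l'] by blast
    have "l + l' = (a + a') + (c + c')" by (simp add: l algebra_simps)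
    then have "f (l + l') = (a + a', c + c')" using l by (simp only: fg closedA closedC)
    moreover have "br l l' = br a a' + br c c'" using l by (simp add: left.add right.add ac)
    ultimately show ?thesis using l by (simp add: fg closedA closedC)
  qed
  moreover have "f (scl k l) = (scl k (fst (f l)), scl k (snd (f l)))" for k l
  proof -
    obtain a c where l: "l = a + c" "a \<in> A" "c \<in> C" using ex[of l] by blast
    then show ?thesis by (simp add: scale_right_distrib fg closedA closedC)
  qed
  ultimately have "alg_isomorphism f (sub_alg scl br UNIV) (alg_sum (sub_alg scl br A) (sub_alg scl br C))"
    by (simp add: alg_isomorphism_def sub_alg_def alg_sum_def split_beta)
  then show ?thesis unfolding A C_def[symmetric] alg_isomorphic_def by blast
qed

section \<open>The second copy on the weight spaces of the first\<close>

lemma br_pow_commute: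
  assumes "p b = 0"
  shows "br ((E1 ^^ k) x) b = (E1 ^^ k) (br x b)" "br ((F1 ^^ k) x) b = (F1 ^^ k) (br x b)"
  by (induction k) (simp_all add: br_br_commute assms lift)

text \<open>The second alternative records the trivial action beside the complement, because the
  splitting for an arbitrary complement relies on it.\<close>

lemma factor2_dichotomy:
  assumes V1: "T1.irreducible V1" "dim V1 = m + 1" and V2: "T1.irreducible V2" "dim V2 = m + 1"
    and I: "I = {a + b |a b. a \<in> V1 \<and> b \<in> V2}"
  shows "(\<exists>W. internal_direct_sum I {1..m + 1} W \<and> (\<forall>k\<in>{1..m + 1}. T2.irreducible (W k)))
    \<or> (\<exists>S. levi_complement scl br I S) \<and> (\<forall>x b. x \<in> I \<longrightarrow> p b = 0 \<longrightarrow> br x b = 0)"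
proof -
  obtain v1 where v1: "v1 \<in> V1" "v1 \<noteq> 0" "E1 v1 = 0" "H1 v1 = scl (of_nat m) v1"
    "\<And>x. x \<in> V1 \<Longrightarrow> \<exists>c. x = (\<Sum>k\<le>m. scl (c k) ((F1 ^^ k) v1))"
    using T1.irreducible_basis[OF V1(1)] V1(2) by auto
  obtain v2 where v2: "v2 \<in> V2" "v2 \<noteq> 0" "E1 v2 = 0" "H1 v2 = scl (of_nat m) v2"
    "\<And>x. x \<in> V2 \<Longrightarrow> \<exists>c. x = (\<Sum>k\<le>m. scl (c k) ((F1 ^^ k) v2))"
    using T1.irreducible_basis[OF V2(1)] V2(2) by auto
  have inv1: "T1.invariant V1" "T1.invariant V2" using V1 V2 by (auto simp: T1.irreducible_def)
  then have sub: "subspace V1" "subspace V2" by (auto simp: T1.invariant_def)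
  have VI: "V1 \<subseteq> I" "V2 \<subseteq> I"
  proof -
    have "a + 0 \<in> I" if "a \<in> V1" for a
      unfolding I using that subspace_0[OF sub(2)] by blast
    moreover have "0 + b \<in> I" if "b \<in> V2" for b
      unfolding I using that subspace_0[OF sub(1)] by blast
    ultimately show "V1 \<subseteq> I" "V2 \<subseteq> I" by auto
  qed
  define l :: "nat \<Rightarrow> complex" where "l k = of_nat m - 2 * of_nat k" for k
  have inj_l: "inj l" by (auto simp: inj_def l_def)
  define W where "W k = {x \<in> I. H1 x = scl (l k) x}" for k
  have FW: "(F1 ^^ k) v1 \<in> W k" "(F1 ^^ k) v2 \<in> W k" for k
    using T1.H_F_pow[OF v1(4)] T1.H_F_pow[OF v2(4)] T1.pow_mem[OF inv1(1) v1(1)]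
      T1.pow_mem[OF inv1(2) v2(1)] VI by (auto simp: W_def l_def)
  have sW: "subspace (W k)" for k
    using subspace_kernel
    by (intro subspaceI)
      (auto simp: W_def left.add left.scale scale_right_distrib mult.commute
        subspace_0 subspace_add subspace_scale)
  have expand: "\<exists>c d. x = (\<Sum>k\<le>m. scl (c k) ((F1 ^^ k) v1) + scl (d k) ((F1 ^^ k) v2))"
    if xI: "x \<in> I" for x
  proof -
    obtain a b where "x = a + b" "a \<in> V1" "b \<in> V2" using xI unfolding I by blast
    moreover from this obtain c d where "a = (\<Sum>k\<le>m. scl (c k) ((F1 ^^ k) v1))"
      "b = (\<Sum>k\<le>m. scl (d k) ((F1 ^^ k) v2))"
      using v1(5) v2(5) by blast
    ultimately show ?thesis by (intro exI[of _ c] exI[of _ d]) (simp add: sum.distrib)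
  qed
  \<comment> \<open>Linear conditions on \<open>I\<close> need checking only on the two weight
    strings; this serves for the trivial action, the Casimir operator and the weights.\<close>
  have span_I: "x \<in> X"
    if "subspace X" "\<And>k. k \<le> m \<Longrightarrow> (F1 ^^ k) v1 \<in> X" "\<And>k. k \<le> m \<Longrightarrow> (F1 ^^ k) v2 \<in> X" and xI: "x \<in> I"
    for X x
  proof -
    obtain c d where x: "x = (\<Sum>k\<le>m. scl (c k) ((F1 ^^ k) v1) + scl (d k) ((F1 ^^ k) v2))"
      using expand[OF xI] by blast
    show ?thesis unfolding x
      using that by (intro subspace_sum that(1) subspace_add subspace_scale) auto
  qed
  have zero: "u k = 0" if "(\<Sum>k\<le>m. u k) = 0" "\<And>k. k \<le> m \<Longrightarrow> u k \<in> W k" "k \<le> m" for u k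
    by (rule eigenvectors_sum_zero[OF T1.linear_H finite_atMost inj_on_subset[OF inj_l subset_UNIV] _ that(1)])
      (use that in \<open>auto simp: W_def\<close>)
  have W_span: "W k \<subseteq> span {(F1 ^^ k) v1, (F1 ^^ k) v2}" if "k \<le> m" for k
  proof
    fix x assume x: "x \<in> W k"
    then obtain c d where cd: "x = (\<Sum>k\<le>m. scl (c k) ((F1 ^^ k) v1) + scl (d k) ((F1 ^^ k) v2))"
      using expand[of x] unfolding W_def by blast
    let ?w = "\<lambda>k. scl (c k) ((F1 ^^ k) v1) + scl (d k) ((F1 ^^ k) v2)"
    \<comment> \<open>Moving \<open>x\<close> into its own weight component turns the expansion into
      a vanishing sum of weight vectors, so the k-th term \<open>?w k - x\<close> is zero.\<close>
    let ?u = "\<lambda>j. ?w j - (if j = k then x else 0)"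
    have "(\<Sum>j\<le>m. ?u j) = 0" using that cd by (simp add: sum_subtractf)
    moreover have "?u j \<in> W j" for j
      using x FW sW by (auto intro!: subspace_diff subspace_add subspace_scale subspace_0)
    ultimately have "?u k = 0" using zero[of ?u k] that by blast
    then have "x = ?w k" by simp
    then show "x \<in> span {(F1 ^^ k) v1, (F1 ^^ k) v2}"
      by (metis insertI1 insertI2 span_add span_base span_scale)
  qed
  have W_inv: "T2.invariant (W k)" for k
    unfolding invariant2_iff
  proof (intro conjI ballI allI impI sW)
    fix w b assume w: "w \<in> W k" and b: "p b = 0"
    have "H1 (br w b) = br (H1 w) b" using b by (intro br_br_commute[symmetric]) (simp_all add: lift)
    also have "\<dots> = scl (l k) (br w b)" using w by (simp add: W_def left.scale)
    finally show "br w b \<in> W k" using w br_mem by (auto simp: W_def)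
  qed
  have W_nz: "W k \<noteq> {0}" if km: "k \<le> m" for k
  proof -
    have "(F1 ^^ k) v1 \<noteq> 0"
    proof
      assume 0: "(F1 ^^ k) v1 = 0"
      obtain c where "c \<noteq> 0" "(E1 ^^ k) ((F1 ^^ k) v1) = scl c v1"
        using T1.E_pow_F_pow[OF km] v1(3,4) by blast
      moreover have "(E1 ^^ k) 0 = 0" by (induction k) (simp_all add: left.zero)
      ultimately show False using v1(2) by (simp add: 0)
    qed
    then show ?thesis using FW by blast
  qed
  have direct: "internal_direct_sum I {1..m + 1} (\<lambda>k. W (k - 1))"
    unfolding internal_direct_sum_def
  proof (rule bij_betw_imageI)
    let ?K = "{1..m + 1}"
    \<comment> \<open>The summands are numbered from 1 but the weight spaces from 0.\<close>
    have shift: "(\<Sum>k\<in>?K. f k) = (\<Sum>k\<le>m. f (Suc k))" for f :: "nat \<Rightarrow> 'a"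
      by (rule sum.reindex_bij_witness[of _ Suc "\<lambda>k. k - 1"]) auto
    show "inj_on (\<lambda>f. \<Sum>k\<in>?K. f k) (Pi\<^sub>E ?K (\<lambda>k. W (k - 1)))"
    proof (rule inj_onI)
      fix f g assume f: "f \<in> Pi\<^sub>E ?K (\<lambda>k. W (k - 1))" and g: "g \<in> Pi\<^sub>E ?K (\<lambda>k. W (k - 1))"
        and eq: "(\<Sum>k\<in>?K. f k) = (\<Sum>k\<in>?K. g k)"
      have mem: "f (Suc k) \<in> W k" "g (Suc k) \<in> W k" if "k \<le> m" for k
        using PiE_mem[OF f, of "Suc k"] PiE_mem[OF g, of "Suc k"] that by auto
      have "f (Suc k) - g (Suc k) = 0" if "k \<le> m" for k
        by (rule zero[of "\<lambda>k. f (Suc k) - g (Suc k)"])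
          (use eq[unfolded shift] mem sW that in \<open>auto simp: sum_subtractf intro!: subspace_diff\<close>)
      then have "f k = g k" if "k \<in> ?K" for k
        using that by (cases k) auto
      then show "f = g" using f g by (intro PiE_ext) auto
    qed
    show "(\<lambda>f. \<Sum>k\<in>?K. f k) ` Pi\<^sub>E ?K (\<lambda>k. W (k - 1)) = I"
    proof (intro equalityI subsetI)
      fix x assume "x \<in> (\<lambda>f. \<Sum>k\<in>?K. f k) ` Pi\<^sub>E ?K (\<lambda>k. W (k - 1))"
      then obtain f where x: "x = (\<Sum>k\<in>?K. f k)" and f: "f \<in> Pi\<^sub>E ?K (\<lambda>k. W (k - 1))" by blast
      have "f k \<in> I" if "k \<in> ?K" for k using PiE_mem[OF f that] by (simp add: W_def)
      then show "x \<in> I" unfolding x by (rule subspace_sum[OF subspace_kernel])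
    next
      fix x assume "x \<in> I"
      then obtain c d where x: "x = (\<Sum>k\<le>m. scl (c k) ((F1 ^^ k) v1) + scl (d k) ((F1 ^^ k) v2))"
        using expand by blast
      let ?f = "\<lambda>k\<in>?K. scl (c (k-1)) ((F1 ^^ (k-1)) v1) + scl (d (k-1)) ((F1 ^^ (k-1)) v2)"
      have "x = (\<Sum>k\<in>?K. ?f k)" unfolding shift x by (intro sum.cong) auto
      moreover have "?f \<in> Pi\<^sub>E ?K (\<lambda>k. W (k - 1))"
        using FW sW by (auto intro!: subspace_add subspace_scale)
      ultimately show "x \<in> (\<lambda>f. \<Sum>k\<in>?K. f k) ` Pi\<^sub>E ?K (\<lambda>k. W (k - 1))" by (rule image_eqI)
    qed
  qed
  show ?thesis
  proof (cases "\<forall>k\<le>m. T2.irreducible (W k)")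
    case True
    then show ?thesis using direct by (intro disjI1 exI[of _ "\<lambda>k. W (k - 1)"]) auto
  next
    case False
    then obtain k where k: "k \<le> m" "\<not> T2.irreducible (W k)" by blast
    have kill: "br x b = 0" if x: "x \<in> W k" and b: "p b = 0" for x b
    proof -
      have "E2 x = 0" "F2 x = 0" "H2 x = 0"
        using T2.reducible_plane_trivial[OF W_inv W_nz[OF k(1)] W_span[OF k(1)] k(2) x] by auto
      then show ?thesis using br_factor2[OF b] by (metis add_0 scale_zero_right)
    qed
    obtain c where c: "c \<noteq> 0"
      "\<And>y. E1 y = 0 \<Longrightarrow> H1 y = scl (of_nat m) y \<Longrightarrow> (E1 ^^ k) ((F1 ^^ k) y) = scl c y"
      using T1.E_pow_F_pow[OF k(1)] by blast
    \<comment> \<open>Right multiplication by \<open>b\<close> commutes with the powers of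
      \<open>E1\<close> and \<open>F1\<close>, so its vanishing at depth \<open>k\<close> of the
      string is carried back to the top.\<close>
    have kill_v: "br v b = 0"
      if v: "E1 v = 0" "H1 v = scl (of_nat m) v" "(F1 ^^ k) v \<in> W k" and b: "p b = 0" for v b
    proof -
      have "scl c (br v b) = br ((E1 ^^ k) ((F1 ^^ k) v)) b" by (simp add: c(2)[OF v(1,2)] left.scale)
      also have "\<dots> = (E1 ^^ k) 0" 
        unfolding br_pow_commute[OF b] using kill[OF v(3) b] br_pow_commute(2)[OF b, of k v] by simp
      also have "\<dots> = 0" by (induction k) (simp_all add: left.zero)
      finally show ?thesis using c(1) by simp
    qed
    have F0: "(F1 ^^ j) 0 = 0" for j by (induction j) (simp_all add: left.zero)
    have triv: "br x b = 0" if x: "x \<in> I" and b: "p b = 0" for x b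
    proof -
      have "x \<in> {x. br x b = 0}"
      proof (rule span_I[OF _ _ _ x])
        show "subspace {x. br x b = 0}" by (rule subspaceI) (simp_all add: left.zero left.add left.scale)
      qed (simp_all add: br_pow_commute(2)[OF b] F0 kill_v[OF v1(3,4) FW(1) b] kill_v[OF v2(3,4) FW(2) b])
      then show ?thesis by simp
    qed
    have cas: "T1.casimir x = scl (of_nat (m * (m + 2))) x" if x: "x \<in> I" for x
    proof -
      interpret C: Vector_Spaces.linear scl scl T1.casimir by (rule T1.linear_casimir)
      have "x \<in> {x. T1.casimir x = scl (of_nat (m * (m + 2))) x}"
      proof (rule span_I[OF _ _ _ x])
        show "subspace {x. T1.casimir x = scl (of_nat (m * (m + 2))) x}"
          by (rule subspaceI) (simp_all add: C.zero C.add C.scale scale_right_distrib mult.commute)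
      qed (use T1.casimir_highest_weight[OF v1(3,4)] T1.casimir_highest_weight[OF v2(3,4)] in auto)
      then show ?thesis by simp
    qed
    \<comment> \<open>For m = 2 the weights are 2, 0, -2, the roots of t^3 - 4 t.\<close>
    have wts: "H1 (H1 (H1 x)) = scl 4 (H1 x)" if m: "m = 2" and x: "x \<in> I" for x
    proof -
      have "x \<in> {x. H1 (H1 (H1 x)) = scl 4 (H1 x)}"
      proof (rule span_I[OF _ _ _ x])
        show "subspace {x. H1 (H1 (H1 x)) = scl 4 (H1 x)}"
          by (rule subspaceI) (simp_all add: left.zero left.add left.scale scale_right_distrib mult.commute)
      next
        fix k assume "k \<le> m"
        then have "k = 0 \<or> k = 1 \<or> k = 2" using m by auto
        then have "l k * (l k * l k) = 4 * l k" using m by (auto simp: l_def)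
        moreover have "H1 ((F1 ^^ k) v1) = scl (l k) ((F1 ^^ k) v1)" "H1 ((F1 ^^ k) v2) = scl (l k) ((F1 ^^ k) v2)"
          using FW by (auto simp: W_def)
        ultimately show "(F1 ^^ k) v1 \<in> {x. H1 (H1 (H1 x)) = scl 4 (H1 x)}"
          "(F1 ^^ k) v2 \<in> {x. H1 (H1 (H1 x)) = scl 4 (H1 x)}"
          by (simp_all add: left.scale)
      qed
      then show ?thesis by simp
    qed
    have "\<exists>S. levi_complement scl br I S"
      by (rule levi_complement_exists[OF triv cas wts])
    then show ?thesis using triv by blast
  qed
qed

end

section \<open>The ideal generated by the squares\<close>

context leibniz_algebra
begin

lemma subspace_of_ideal: "leibniz_ideal scl br J \<Longrightarrow> subspace J"
  by (simp add: leibniz_ideal_def)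

lemma squares_ideal_is_ideal: "leibniz_ideal scl br (squares_ideal scl br)"
  unfolding squares_ideal_def
proof (rule hull_in)
  fix T assume T: "\<forall>J\<in>T. leibniz_ideal scl br J"
  then have "subspace (\<Inter>T)" by (intro subspace_Inter) (auto intro: subspace_of_ideal)
  then show "leibniz_ideal scl br (\<Inter>T)" using T by (auto simp: leibniz_ideal_def)
qed

text \<open>The elements with zero right multiplication form an ideal, and the Leibniz identity with
  y = z puts every square into it.\<close>

lemma br_squares_ideal:
  assumes "y \<in> squares_ideal scl br"
  shows "br x y = 0"
proof -
  interpret left: Vector_Spaces.linear scl scl "\<lambda>x. br x y" for y by (rule linear_left)
  interpret right: Vector_Spaces.linear scl scl "\<lambda>y. br x y" for x by (rule linear_right)
  let ?R = "{y. \<forall>x. br x y = 0}"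
  have "subspace ?R" by (rule subspaceI) (auto simp: right.zero right.add right.scale)
  moreover have "br x (br y a) = 0 \<and> br x (br a y) = 0" if "y \<in> ?R" for x y a
    using that by (simp add: leibniz_identity left.zero)
  ultimately have "leibniz_ideal scl br ?R" by (auto simp: leibniz_ideal_def)
  moreover have "range (\<lambda>x. br x x) \<subseteq> ?R" by (auto simp: leibniz_identity)
  ultimately have "squares_ideal scl br \<subseteq> ?R"
    unfolding squares_ideal_def by (rule hull_minimal[rotated])
  then show ?thesis using assms by blast
qed

end

section \<open>Translation into cosets, submodules and Levi factors\<close>

lemma sl2_carrier: "A \<in> alg_carrier sl2 \<longleftrightarrow> trace A = 0"
  by (simp add: sl2_def)

context leibniz_over_sl2_sl2
begin

context
  fixes \<phi> :: "(complex^2^2) \<times> (complex^2^2) \<Rightarrow> 'a set"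
  assumes \<phi>: "\<And>A C. trace A = 0 \<Longrightarrow> trace C = 0 \<Longrightarrow> \<phi> (A, C) = {y. p y = A \<and> q y = C}"
begin

lemma quotient_act_eq:
  assumes "trace A = 0" "trace C = 0"
  shows "quotient_act br x (\<phi> (A, C)) = br x (lift A C)"
proof -
  have "br x ` {y. p y = A \<and> q y = C} = {br x (lift A C)}"
  proof (intro equalityI subsetI)
    fix z assume "z \<in> {br x (lift A C)}"
    then show "z \<in> br x ` {y. p y = A \<and> q y = C}" using lift[OF assms] by auto
  next
    fix z assume "z \<in> br x ` {y. p y = A \<and> q y = C}"
    then obtain y where y: "p y = A" "q y = C" "z = br x y" by blast
    then show "z \<in> {br x (lift A C)}" using br_cong[of y "lift A C" x] lift[OF assms] by simp
  qed
  then show ?thesis by (simp add: quotient_act_def \<phi>[OF assms])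
qed

lemma submodule1_iff: "submodule scl (alg_carrier sl2) (act1 br \<phi>) W \<longleftrightarrow> T1.invariant W"
proof -
  have "(\<forall>A\<in>alg_carrier sl2. act1 br \<phi> w A \<in> W) \<longleftrightarrow> (\<forall>b. q b = 0 \<longrightarrow> br w b \<in> W)" for w
  proof safe
    fix b assume "\<forall>A\<in>alg_carrier sl2. act1 br \<phi> w A \<in> W" "q b = 0"
    moreover have "br w (lift (p b) 0) = br w b"
      using \<open>q b = 0\<close> by (intro br_cong) (simp_all add: lift trace_p)
    ultimately show "br w b \<in> W"
      by (auto simp: act1_def sl2_carrier quotient_act_eq trace_p dest!: bspec[of _ _ "p b"])
  qed (simp add: act1_def sl2_carrier quotient_act_eq lift)
  then show ?thesis by (simp add: submodule_def invariant1_iff)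
qed

lemma submodule2_iff: "submodule scl (alg_carrier sl2) (act2 br \<phi>) W \<longleftrightarrow> T2.invariant W"
proof -
  have "(\<forall>A\<in>alg_carrier sl2. act2 br \<phi> w A \<in> W) \<longleftrightarrow> (\<forall>b. p b = 0 \<longrightarrow> br w b \<in> W)" for w
  proof safe
    fix b assume "\<forall>A\<in>alg_carrier sl2. act2 br \<phi> w A \<in> W" "p b = 0"
    moreover have "br w (lift 0 (q b)) = br w b"
      using \<open>p b = 0\<close> by (intro br_cong) (simp_all add: lift trace_q)
    ultimately show "br w b \<in> W"
      by (auto simp: act2_def sl2_carrier quotient_act_eq trace_q dest!: bspec[of _ _ "q b"])
  qed (simp add: act2_def sl2_carrier quotient_act_eq lift)
  then show ?thesis by (simp add: submodule_def invariant2_iff)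
qed

lemma irreducible_submodule_iff:
  "irreducible_submodule scl (alg_carrier sl2) (act1 br \<phi>) W \<longleftrightarrow> T1.irreducible W"
  "irreducible_submodule scl (alg_carrier sl2) (act2 br \<phi>) W \<longleftrightarrow> T2.irreducible W"
  unfolding irreducible_submodule_def T1.irreducible_def T2.irreducible_def
  by (simp_all add: submodule1_iff submodule2_iff)

lemma levi_factor_eq:
  "levi1 I \<phi> S = {s \<in> S. q s = 0}" "levi2 I \<phi> S = {s \<in> S. p s = 0}"
proof -
  have coset: "coset_rel I `` {x} = \<phi> (A, C) \<longleftrightarrow> p x = A \<and> q x = C"
    if "trace A = 0" "trace C = 0" for x A C
  proof -
    have K: "coset_rel I `` {x} = {y. p y = p x \<and> q y = q x}"
      by (auto simp: coset_rel_def kernel[symmetric] pq_simps)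
    show ?thesis unfolding K \<phi>[OF that]
    proof
      assume "{y. p y = p x \<and> q y = q x} = {y. p y = A \<and> q y = C}"
      then have "x \<in> {y. p y = A \<and> q y = C}" by (rule subst) simp
      then show "p x = A \<and> q x = C" by simp
    qed simp
  qed
  have "(\<exists>A\<in>alg_carrier sl2. coset_rel I `` {x} = \<phi> (A, 0)) \<longleftrightarrow> q x = 0" for x
    using coset[of _ 0 x] trace_p[of x] unfolding sl2_carrier Bex_def by auto
  then show "levi1 I \<phi> S = {s \<in> S. q s = 0}" by (simp add: levi1_def)
  have "(\<exists>A\<in>alg_carrier sl2. coset_rel I `` {x} = \<phi> (0, A)) \<longleftrightarrow> p x = 0" for x
    using coset[of 0 _ x] trace_q[of x] unfolding sl2_carrier Bex_def by auto
  then show "levi2 I \<phi> S = {s \<in> S. p s = 0}" by (simp add: levi2_def)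
qed

lemma module_dichotomy:
  fixes I1 :: "nat \<Rightarrow> 'a set"
  assumes sum: "internal_direct_sum I {1..2} I1"
    and irr: "\<And>j. j \<in> {1..2} \<Longrightarrow>
      irreducible_submodule scl (alg_carrier sl2) (act1 br \<phi>) (I1 j) \<and> dim (I1 j) = m + 1"
  shows "(\<exists>I2 :: nat \<Rightarrow> 'a set.
            internal_direct_sum I {1..m + 1} I2 \<and>
            (\<forall>k\<in>{1..m + 1}.
               irreducible_submodule scl (alg_carrier sl2) (act2 br \<phi>) (I2 k)))
       \<or> ((\<exists>S. levi_complement scl br I S) \<and>
          (\<forall>S. levi_complement scl br I S \<longrightarrow>
             alg_isomorphic (sub_alg scl br UNIV)
               (alg_sum
                 (sub_alg scl br {x + i |x i. x \<in> levi1 I \<phi> S \<and> i \<in> I})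
                 (sub_alg scl br (levi2 I \<phi> S)))))"
proof -
  have two: "{1..2} = {1, 2 :: nat}" by auto
  have "I = (\<lambda>f. \<Sum>k\<in>{1..2}. f k) ` Pi\<^sub>E {1..2::nat} I1"
    using sum by (simp add: internal_direct_sum_def bij_betw_def)
  also have "\<dots> = {a + b |a b. a \<in> I1 1 \<and> b \<in> I1 2}"
  proof (intro equalityI subsetI)
    fix x assume "x \<in> (\<lambda>f. \<Sum>k\<in>{1..2}. f k) ` Pi\<^sub>E {1..2::nat} I1"
    then obtain f where "x = f 1 + f 2" "f \<in> Pi\<^sub>E {1, 2::nat} I1" unfolding two by auto
    then show "x \<in> {a + b |a b. a \<in> I1 1 \<and> b \<in> I1 2}" by auto
  next
    fix x assume "x \<in> {a + b |a b. a \<in> I1 1 \<and> b \<in> I1 2}"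
    then obtain a b where x: "x = a + b" "a \<in> I1 1" "b \<in> I1 2" by blast
    let ?f = "\<lambda>k\<in>{1..2::nat}. if k = 1 then a else b"
    have "x = (\<Sum>k\<in>{1..2}. ?f k)" unfolding two by (simp add: x)
    moreover have "?f \<in> Pi\<^sub>E {1..2::nat} I1" using x unfolding two by auto
    ultimately show "x \<in> (\<lambda>f. \<Sum>k\<in>{1..2}. f k) ` Pi\<^sub>E {1..2::nat} I1" by (rule image_eqI)
  qed
  finally have I: "I = {a + b |a b. a \<in> I1 1 \<and> b \<in> I1 2}" .
  have "T1.irreducible (I1 1)" "dim (I1 1) = m + 1" "T1.irreducible (I1 2)" "dim (I1 2) = m + 1"
    using irr[of 1] irr[of 2] by (simp_all add: irreducible_submodule_iff)
  from factor2_dichotomy[OF this I] show ?thesis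
  proof (elim disjE conjE)
    assume "\<exists>W. internal_direct_sum I {1..m + 1} W \<and> (\<forall>k\<in>{1..m + 1}. T2.irreducible (W k))"
    then show ?thesis
      unfolding irreducible_submodule_iff by (rule disjI1)
  next
    assume ex: "\<exists>S. levi_complement scl br I S"
      and triv: "\<forall>x b. x \<in> I \<longrightarrow> p b = 0 \<longrightarrow> br x b = 0"
    show ?thesis
      unfolding levi_factor_eq
      by (intro disjI2 conjI ex allI impI levi_complement_splits) (simp_all add: triv)
  qed
qed

end

end

theorem theorem4p3:
  fixes scl :: "complex \<Rightarrow> 'a::ab_group_add \<Rightarrow> 'a"
    and br :: "'a \<Rightarrow> 'a \<Rightarrow> 'a"
    and Basis I :: "'a set"
    and \<phi> :: "(complex^2^2) \<times> (complex^2^2) \<Rightarrow> 'a set"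
    and I1 :: "nat \<Rightarrow> 'a set"
    and m :: nat
  assumes "leibniz_algebra scl br"
    and "finite_dimensional_vector_space scl Basis"
    and "I = squares_ideal scl br"
    and "alg_isomorphism \<phi> (alg_sum sl2 sl2) (quotient_alg scl br I)"
    and "internal_direct_sum I {1..2} I1"
    and "\<And>j. j \<in> {1..2} \<Longrightarrow>
           irreducible_submodule scl (alg_carrier sl2) (act1 br \<phi>) (I1 j) \<and>
           vector_space.dim scl (I1 j) = m + 1"
  shows "(\<exists>I2 :: nat \<Rightarrow> 'a set.
            internal_direct_sum I {1..m + 1} I2 \<and>
            (\<forall>k\<in>{1..m + 1}.
               irreducible_submodule scl (alg_carrier sl2) (act2 br \<phi>) (I2 k)))
       \<or> ((\<exists>S. levi_complement scl br I S) \<and>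
          (\<forall>S. levi_complement scl br I S \<longrightarrow>
             alg_isomorphic (sub_alg scl br UNIV)
               (alg_sum
                 (sub_alg scl br {x + i |x i. x \<in> levi1 I \<phi> S \<and> i \<in> I})
                 (sub_alg scl br (levi2 I \<phi> S)))))"
proof -
  interpret leibniz_algebra scl br by (rule assms(1))
  interpret fd: finite_dimensional_vector_space scl Basis by (rule assms(2))
  interpret left: Vector_Spaces.linear scl scl "\<lambda>x. br x y" for y by (rule linear_left)
  interpret right: Vector_Spaces.linear scl scl "\<lambda>y. br x y" for x by (rule linear_right)
  have ideal: "leibniz_ideal scl br I" unfolding assms(3) by (rule squares_ideal_is_ideal)
  then have sI: "subspace I" and brI: "\<And>x a. x \<in> I \<Longrightarrow> br x a \<in> I"
    by (auto simp: leibniz_ideal_def)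
  have kill: "br x y = 0" if "y \<in> I" for x y
    using br_squares_ideal that unfolding assms(3) .
  define K where "K x = coset_rel I `` {x}" for x
  have K_mem: "y \<in> K x \<longleftrightarrow> x - y \<in> I" for x y by (simp add: K_def coset_rel_def)
  have K_self: "x \<in> K x" for x using subspace_0[OF sI] by (simp add: K_mem)
  have K_eq: "K x = K y \<longleftrightarrow> x - y \<in> I" for x y
  proof
    show "x - y \<in> I" if "K x = K y"
      unfolding K_mem[symmetric] that by (rule K_self)
    assume xy: "x - y \<in> I"
    have "x - z \<in> I \<longleftrightarrow> y - z \<in> I" for z
      using subspace_diff[OF sI, of "x - z" "x - y"] subspace_add[OF sI, of "y - z" "x - y"] xy by auto
    then show "K x = K y" by (auto simp: K_mem)
  qed
  let ?Q = "quotient_alg scl br I" and ?C = "{A :: complex^2^2. trace A = 0} \<times> {A :: complex^2^2. trace A = 0}"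
  have Q: "alg_add ?Q X Y = (\<Union>x\<in>X. \<Union>y\<in>Y. K (x + y))" "alg_scale ?Q c X = (\<Union>x\<in>X. K (scl c x))"
    "alg_br ?Q X Y = (\<Union>x\<in>X. \<Union>y\<in>Y. K (br x y))" for X Y c
    by (simp_all add: quotient_alg_def K_def)
  \<comment> \<open>Operations on cosets are unions over all representatives. Over a nonempty coset
    a constant family has its common value as union, so it remains to check independence of
    representatives.\<close>
  have UN_K: "(\<Union>y\<in>K x. f y) = Z" if "\<And>y. y \<in> K x \<Longrightarrow> f y = Z" for x f and Z :: "'a set"
    using that K_self[of x] by blast
  have Q_add: "alg_add ?Q (K x) (K y) = K (x + y)" for x y
  proof -
    have "K (x' + y') = K (x + y)" if "x' \<in> K x" "y' \<in> K y" for x' y'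
    proof -
      have "(x + y) - (x' + y') \<in> I"
        using subspace_add[OF sI, of "x - x'" "y - y'"] that by (simp add: K_mem add_diff_add)
      then show ?thesis unfolding K_eq[symmetric] ..
    qed
    then show ?thesis unfolding Q by (intro UN_K)
  qed
  have Q_scale: "alg_scale ?Q c (K x) = K (scl c x)" for c x
  proof -
    have "K (scl c x') = K (scl c x)" if "x' \<in> K x" for x'
    proof -
      have "scl c x - scl c x' \<in> I"
        using subspace_scale[OF sI, of "x - x'" c] that by (simp add: K_mem scale_right_diff_distrib)
      then show ?thesis unfolding K_eq[symmetric] ..
    qed
    then show ?thesis unfolding Q by (intro UN_K)
  qed
  have Q_br: "alg_br ?Q (K x) (K y) = K (br x y)" for x y
  proof -
    have "K (br x' y') = K (br x y)" if "x' \<in> K x" "y' \<in> K y" for x' y'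
    proof -
      have "br x' y' = br x' y" using kill[of "y - y'" x'] that by (simp add: K_mem right.diff)
      moreover have "br x y - br x' y \<in> I" using brI[of "x - x'" y] that by (simp add: K_mem left.diff)
      ultimately have "br x y - br x' y' \<in> I" by simp
      then show ?thesis unfolding K_eq[symmetric] ..
    qed
    then show ?thesis unfolding Q by (intro UN_K)
  qed
  have carrier: "alg_carrier (alg_sum sl2 sl2) = ?C" "alg_carrier ?Q = range K"
    by (auto simp: alg_sum_def sl2_def quotient_alg_def quotient_def K_def)
  have bij: "bij_betw \<phi> ?C (range K)"
    using assms(4) by (simp add: alg_isomorphism_def carrier)
  \<comment> \<open>The projection of \<open>L\<close> onto \<open>L/I\<close>, read in the sum of
    two copies of \<open>sl2\<close> through the inverse of \<open>\<phi>\<close>. Its components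
    are the maps \<open>p\<close> and \<open>q\<close> of the locale.\<close>
  define g where "g x = the_inv_into ?C \<phi> (K x)" for x
  have \<phi>g: "\<phi> (g x) = K x" for x
    unfolding g_def using bij by (intro f_the_inv_into_f_bij_betw[OF bij]) auto
  have gC: "g x \<in> ?C" for x
    unfolding g_def by (rule bij_betw_apply[OF bij_betw_the_inv_into[OF bij]]) simp
  have g_eqI: "g x = z" if "z \<in> ?C" "\<phi> z = K x" for x z
    by (rule inj_onD[OF bij_betw_imp_inj_on[OF bij] _ gC that(1)]) (simp only: that(2) \<phi>g)
  have hom: "\<phi> (alg_add (alg_sum sl2 sl2) z w) = alg_add ?Q (\<phi> z) (\<phi> w)"
      "\<phi> (alg_br (alg_sum sl2 sl2) z w) = alg_br ?Q (\<phi> z) (\<phi> w)"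
      "\<phi> (alg_scale (alg_sum sl2 sl2) c z) = alg_scale ?Q c (\<phi> z)" if "z \<in> ?C" "w \<in> ?C" for z w c
    using assms(4) that unfolding alg_isomorphism_def carrier by blast+
  have tr: "trace (A ** B - B ** A) = 0" for A B :: "complex^2^2"
    by (simp add: mat2_simps algebra_simps)
  have g_add: "g (x + y) = (fst (g x) + fst (g y), snd (g x) + snd (g y))" for x y
  proof (rule g_eqI)
    show "\<phi> (fst (g x) + fst (g y), snd (g x) + snd (g y)) = K (x + y)"
      using hom(1)[OF gC[of x] gC[of y]] by (simp add: alg_sum_def sl2_def split_beta \<phi>g Q_add)
  qed (use gC[of x] gC[of y] in \<open>auto simp: mem_Times_iff trace_def sum.distrib\<close>)
  have g_br: "g (br x y) = (commutator (fst (g x)) (fst (g y)), commutator (snd (g x)) (snd (g y)))" for x y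
  proof (rule g_eqI)
    show "\<phi> (commutator (fst (g x)) (fst (g y)), commutator (snd (g x)) (snd (g y))) = K (br x y)"
      using hom(2)[OF gC[of x] gC[of y]]
      by (simp add: alg_sum_def sl2_def split_beta \<phi>g Q_br commutator_def)
  qed (simp add: commutator_def tr)
  have g_scale: "g (scl c x) = (mat_scale c (fst (g x)), mat_scale c (snd (g x)))" for c x
  proof (rule g_eqI)
    show "\<phi> (mat_scale c (fst (g x)), mat_scale c (snd (g x))) = K (scl c x)"
      using hom(3)[OF gC[of x] gC[of x]]
      by (simp add: alg_sum_def sl2_def split_beta \<phi>g Q_scale mat_scale_def)
  qed (use gC[of x] in \<open>auto simp: mem_Times_iff trace_def mat_scale_def simp flip: sum_distrib_left\<close>)
  have g_eq: "g x = g y \<longleftrightarrow> x - y \<in> I" for x y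
  proof
    assume "g x = g y"
    then have "K x = K y" unfolding \<phi>g[symmetric] by simp
    then show "x - y \<in> I" by (simp only: K_eq)
  next
    assume "x - y \<in> I"
    then have "K x = K y" by (simp only: K_eq)
    then show "g x = g y" by (simp only: g_def)
  qed
  have g0: "g 0 = (0, 0)" using g_add[of 0 0] by (simp add: prod_eq_iff)
  have g_\<phi>: "\<phi> z = K x \<longleftrightarrow> g x = z" if "z \<in> ?C" for z x
    using g_eqI[OF that, of x] \<phi>g[of x] by metis
  interpret leibniz_over_sl2_sl2 scl br Basis I "fst \<circ> g" "snd \<circ> g"
  proof
    fix A C :: "complex^2^2" assume "trace A = 0" "trace C = 0"
    then have z: "(A, C) \<in> ?C" by simp
    then obtain x where "\<phi> (A, C) = K x" using bij_betw_apply[OF bij] by blast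
    then have "g x = (A, C)" using g_\<phi>[OF z] by blast
    then show "\<exists>x. (fst \<circ> g) x = A \<and> (snd \<circ> g) x = C" by (intro exI[of _ x]) simp
  next
    fix x show "(fst \<circ> g) x = 0 \<and> (snd \<circ> g) x = 0 \<longleftrightarrow> x \<in> I"
      using g_eq[of x 0] by (simp add: g0 prod_eq_iff)
  qed (use gC in \<open>auto simp: g_add g_br g_scale kill mem_Times_iff\<close>)
  have "\<phi> (A, C) = {y. (fst \<circ> g) y = A \<and> (snd \<circ> g) y = C}" if "trace A = 0" "trace C = 0" for A C
  proof -
    have z: "(A, C) \<in> ?C" using that by simp
    then obtain x where x: "\<phi> (A, C) = K x" using bij_betw_apply[OF bij] by blast
    then have "g x = (A, C)" using g_\<phi>[OF z] by simp
    moreover have "K x = {y. g y = g x}"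
      unfolding set_eq_iff mem_Collect_eq K_mem g_eq[symmetric] by (simp add: eq_commute)
    ultimately show ?thesis using x by (auto simp: prod_eq_iff)
  qed
  from module_dichotomy[OF this assms(5,6)] show ?thesis .
qed

end
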